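(* Let $P$ be an infinite field, let $\Theta$ be the variety of all Lie algebras over $P$, and let $\Theta^0$ be the category of finitely generated free Lie algebras over $P$. Then every automorphism of the category $\Theta^0$ is semi-inner; that is, for every automorphism $\varphi:\Theta^0\to\Theta^0$ there are a field automorphism $\sigma\in\mathrm{Aut}(P)$ and, for every object $F$ of $\Theta^0$, a semi-isomorphism $(\sigma,s_F):F\to\varphi(F)$ such that $\varphi(\nu)=s_{F_2}\,\nu\, s_{F_1}^{-1}$ for every morphism $\nu:F_1\to F_2$ of $\Theta^0$.
   Context: The objects of $\Theta^0$ are the free Lie algebras $F=F(X)$ over $P$, where $X$ runs over the finite subsets of a fixed infinite set (the universal set of variables); morphisms are all homomorphisms of Lie $P$-algebras. An automorphism of a category $\mathcal C$ is a functor $\mathcal C\to\mathcal C$ having a two-sided inverse functor (strictly, not up to isomorphism). A semimorphism $(\sigma,\nu):A\to B$ of Lie algebras over $P$ consists of $\sigma\in\mathrm{Aut}(P)$ and a homomorphism of Lie rings $\nu:A\to B$ with $\nu(\lambda a)=\sigma(\lambda)\nu(a)$ for all $\lambda\in P$, $a\in A$; it is a semi-isomorphism if $\nu$ is bijective. *)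

theory Defs
  imports "HOL-Library.FuncSet"
begin

section \<open>Lie algebras over a field\<close>

record ('p, 'a) lie_struct =
  lcarrier :: "'a set"
  lzero :: 'a
  ladd :: "'a \<Rightarrow> 'a \<Rightarrow> 'a"
  lscale :: "'p \<Rightarrow> 'a \<Rightarrow> 'a"
  lbracket :: "'a \<Rightarrow> 'a \<Rightarrow> 'a"

locale lie_algebra =
  fixes L :: "('p::field, 'a) lie_struct"
  assumes zero_closed: "lzero L \<in> lcarrier L"
    and add_closed: "\<lbrakk>x \<in> lcarrier L; y \<in> lcarrier L\<rbrakk> \<Longrightarrow> ladd L x y \<in> lcarrier L"
    and scale_closed: "x \<in> lcarrier L \<Longrightarrow> lscale L a x \<in> lcarrier L"
    and bracket_closed: "\<lbrakk>x \<in> lcarrier L; y \<in> lcarrier L\<rbrakk> \<Longrightarrow> lbracket L x y \<in> lcarrier L"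
    and add_assoc: "\<lbrakk>x \<in> lcarrier L; y \<in> lcarrier L; z \<in> lcarrier L\<rbrakk>
      \<Longrightarrow> ladd L (ladd L x y) z = ladd L x (ladd L y z)"
    and add_comm: "\<lbrakk>x \<in> lcarrier L; y \<in> lcarrier L\<rbrakk> \<Longrightarrow> ladd L x y = ladd L y x"
    and add_zero: "x \<in> lcarrier L \<Longrightarrow> ladd L (lzero L) x = x"
    and add_inverse: "x \<in> lcarrier L \<Longrightarrow> \<exists>y\<in>lcarrier L. ladd L x y = lzero L"
    and scale_add_right: "\<lbrakk>x \<in> lcarrier L; y \<in> lcarrier L\<rbrakk>
      \<Longrightarrow> lscale L a (ladd L x y) = ladd L (lscale L a x) (lscale L a y)"
    and scale_add_left: "x \<in> lcarrier L
      \<Longrightarrow> lscale L (a + b) x = ladd L (lscale L a x) (lscale L b x)"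
    and scale_scale: "x \<in> lcarrier L \<Longrightarrow> lscale L (a * b) x = lscale L a (lscale L b x)"
    and scale_one: "x \<in> lcarrier L \<Longrightarrow> lscale L 1 x = x"
    and bracket_add_left: "\<lbrakk>x \<in> lcarrier L; y \<in> lcarrier L; z \<in> lcarrier L\<rbrakk>
      \<Longrightarrow> lbracket L (ladd L x y) z = ladd L (lbracket L x z) (lbracket L y z)"
    and bracket_add_right: "\<lbrakk>x \<in> lcarrier L; y \<in> lcarrier L; z \<in> lcarrier L\<rbrakk>
      \<Longrightarrow> lbracket L x (ladd L y z) = ladd L (lbracket L x y) (lbracket L x z)"
    and bracket_scale_left: "\<lbrakk>x \<in> lcarrier L; y \<in> lcarrier L\<rbrakk>
      \<Longrightarrow> lbracket L (lscale L a x) y = lscale L a (lbracket L x y)"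
    and bracket_scale_right: "\<lbrakk>x \<in> lcarrier L; y \<in> lcarrier L\<rbrakk>
      \<Longrightarrow> lbracket L x (lscale L a y) = lscale L a (lbracket L x y)"
    and bracket_self: "x \<in> lcarrier L \<Longrightarrow> lbracket L x x = lzero L"
    and jacobi: "\<lbrakk>x \<in> lcarrier L; y \<in> lcarrier L; z \<in> lcarrier L\<rbrakk>
      \<Longrightarrow> ladd L (ladd L (lbracket L x (lbracket L y z)) (lbracket L y (lbracket L z x)))
            (lbracket L z (lbracket L x y)) = lzero L"

definition lie_ring_hom ::
    "('p, 'a) lie_struct \<Rightarrow> ('p, 'b) lie_struct \<Rightarrow> ('a \<Rightarrow> 'b) \<Rightarrow> bool" where
  "lie_ring_hom A B h \<longleftrightarrow>
     (\<forall>x\<in>lcarrier A. h x \<in> lcarrier B) \<and>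
     (\<forall>x\<in>lcarrier A. \<forall>y\<in>lcarrier A. h (ladd A x y) = ladd B (h x) (h y)) \<and>
     (\<forall>x\<in>lcarrier A. \<forall>y\<in>lcarrier A. h (lbracket A x y) = lbracket B (h x) (h y))"

definition lie_hom ::
    "('p, 'a) lie_struct \<Rightarrow> ('p, 'b) lie_struct \<Rightarrow> ('a \<Rightarrow> 'b) \<Rightarrow> bool" where
  "lie_hom A B h \<longleftrightarrow> lie_ring_hom A B h \<and>
     (\<forall>a. \<forall>x\<in>lcarrier A. h (lscale A a x) = lscale B a (h x))"

definition field_automorphism :: "('p::field \<Rightarrow> 'p) \<Rightarrow> bool" where
  "field_automorphism \<sigma> \<longleftrightarrow> bij \<sigma> \<and> \<sigma> 1 = 1 \<and>
     (\<forall>a b. \<sigma> (a + b) = \<sigma> a + \<sigma> b) \<and> (\<forall>a b. \<sigma> (a * b) = \<sigma> a * \<sigma> b)"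

definition semimorphism ::
    "('p::field, 'a) lie_struct \<Rightarrow> ('p, 'b) lie_struct \<Rightarrow> ('p \<Rightarrow> 'p) \<Rightarrow> ('a \<Rightarrow> 'b) \<Rightarrow> bool" where
  "semimorphism A B \<sigma> h \<longleftrightarrow> field_automorphism \<sigma> \<and> lie_ring_hom A B h \<and>
     (\<forall>a. \<forall>x\<in>lcarrier A. h (lscale A a x) = lscale B (\<sigma> a) (h x))"

definition semi_isomorphism ::
    "('p::field, 'a) lie_struct \<Rightarrow> ('p, 'b) lie_struct \<Rightarrow> ('p \<Rightarrow> 'p) \<Rightarrow> ('a \<Rightarrow> 'b) \<Rightarrow> bool" where
  "semi_isomorphism A B \<sigma> h \<longleftrightarrow> semimorphism A B \<sigma> h \<and> bij_betw h (lcarrier A) (lcarrier B)"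


section \<open>Free Lie algebras\<close>

text \<open>
  The free algebra of the variety of Lie algebras is the algebra of all terms over the
  variables, modulo the least congruence that contains all instances of the identities of the
  variety. The additive inverse of \<^term>\<open>t\<close> is the term \<^term>\<open>Scale (-1) t\<close>.
\<close>

datatype ('p, lvars: 'v) lterm =
    Var 'v
  | Zero
  | Add "('p, 'v) lterm" "('p, 'v) lterm"
  | Scale 'p "('p, 'v) lterm"
  | Bracket "('p, 'v) lterm" "('p, 'v) lterm"

definition lterms :: "'v set \<Rightarrow> ('p, 'v) lterm set" where
  "lterms X = {t. lvars t \<subseteq> X}"

inductive lie_eq :: "'v set \<Rightarrow> ('p::field, 'v) lterm \<Rightarrow> ('p, 'v) lterm \<Rightarrow> bool" for X where
  refl: "t \<in> lterms X \<Longrightarrow> lie_eq X t t"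
| sym: "lie_eq X s t \<Longrightarrow> lie_eq X t s"
| trans: "\<lbrakk>lie_eq X s t; lie_eq X t u\<rbrakk> \<Longrightarrow> lie_eq X s u"
| cong_Add: "\<lbrakk>lie_eq X s s'; lie_eq X t t'\<rbrakk> \<Longrightarrow> lie_eq X (Add s t) (Add s' t')"
| cong_Scale: "lie_eq X t t' \<Longrightarrow> lie_eq X (Scale a t) (Scale a t')"
| cong_Bracket: "\<lbrakk>lie_eq X s s'; lie_eq X t t'\<rbrakk> \<Longrightarrow> lie_eq X (Bracket s t) (Bracket s' t')"
| add_assoc: "\<lbrakk>s \<in> lterms X; t \<in> lterms X; u \<in> lterms X\<rbrakk>
    \<Longrightarrow> lie_eq X (Add (Add s t) u) (Add s (Add t u))"
| add_comm: "\<lbrakk>s \<in> lterms X; t \<in> lterms X\<rbrakk> \<Longrightarrow> lie_eq X (Add s t) (Add t s)"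
| add_zero: "t \<in> lterms X \<Longrightarrow> lie_eq X (Add Zero t) t"
| add_inverse: "t \<in> lterms X \<Longrightarrow> lie_eq X (Add t (Scale (-1) t)) Zero"
| scale_add_right: "\<lbrakk>s \<in> lterms X; t \<in> lterms X\<rbrakk>
    \<Longrightarrow> lie_eq X (Scale a (Add s t)) (Add (Scale a s) (Scale a t))"
| scale_add_left: "t \<in> lterms X
    \<Longrightarrow> lie_eq X (Scale (a + b) t) (Add (Scale a t) (Scale b t))"
| scale_scale: "t \<in> lterms X \<Longrightarrow> lie_eq X (Scale (a * b) t) (Scale a (Scale b t))"
| scale_one: "t \<in> lterms X \<Longrightarrow> lie_eq X (Scale 1 t) t"
| bracket_add_left: "\<lbrakk>s \<in> lterms X; t \<in> lterms X; u \<in> lterms X\<rbrakk>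
    \<Longrightarrow> lie_eq X (Bracket (Add s t) u) (Add (Bracket s u) (Bracket t u))"
| bracket_add_right: "\<lbrakk>s \<in> lterms X; t \<in> lterms X; u \<in> lterms X\<rbrakk>
    \<Longrightarrow> lie_eq X (Bracket s (Add t u)) (Add (Bracket s t) (Bracket s u))"
| bracket_scale_left: "\<lbrakk>s \<in> lterms X; t \<in> lterms X\<rbrakk>
    \<Longrightarrow> lie_eq X (Bracket (Scale a s) t) (Scale a (Bracket s t))"
| bracket_scale_right: "\<lbrakk>s \<in> lterms X; t \<in> lterms X\<rbrakk>
    \<Longrightarrow> lie_eq X (Bracket s (Scale a t)) (Scale a (Bracket s t))"
| bracket_self: "t \<in> lterms X \<Longrightarrow> lie_eq X (Bracket t t) Zero"
| jacobi: "\<lbrakk>s \<in> lterms X; t \<in> lterms X; u \<in> lterms X\<rbrakk>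
    \<Longrightarrow> lie_eq X
          (Add (Add (Bracket s (Bracket t u)) (Bracket t (Bracket u s))) (Bracket u (Bracket s t)))
          Zero"

definition lie_rel :: "'v set \<Rightarrow> (('p::field, 'v) lterm \<times> ('p, 'v) lterm) set" where
  "lie_rel X = {(s, t). lie_eq X s t}"

definition lie_class :: "'v set \<Rightarrow> ('p::field, 'v) lterm \<Rightarrow> ('p, 'v) lterm set" where
  "lie_class X t = lie_rel X `` {t}"

type_synonym ('p, 'v) free_lie_struct = "('p, ('p, 'v) lterm set) lie_struct"

definition free_lie :: "'v set \<Rightarrow> ('p::field, 'v) free_lie_struct" where
  "free_lie X =
     \<lparr>lcarrier = lterms X // lie_rel X,
      lzero = lie_class X Zero,
      ladd = (\<lambda>A B. \<Union>s\<in>A. \<Union>t\<in>B. lie_class X (Add s t)),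
      lscale = (\<lambda>a A. \<Union>t\<in>A. lie_class X (Scale a t)),
      lbracket = (\<lambda>A B. \<Union>s\<in>A. \<Union>t\<in>B. lie_class X (Bracket s t))\<rparr>"

lemma lterms_simps [simp]:
  "Var x \<in> lterms X \<longleftrightarrow> x \<in> X"
  "Zero \<in> lterms X"
  "Add s t \<in> lterms X \<longleftrightarrow> s \<in> lterms X \<and> t \<in> lterms X"
  "Scale a t \<in> lterms X \<longleftrightarrow> t \<in> lterms X"
  "Bracket s t \<in> lterms X \<longleftrightarrow> s \<in> lterms X \<and> t \<in> lterms X"
  by (auto simp: lterms_def)

lemma lie_eq_lterms: "lie_eq X s t \<Longrightarrow> s \<in> lterms X \<and> t \<in> lterms X"
  by (induction rule: lie_eq.induct) auto

lemma equiv_lie_rel: "equiv (lterms X) (lie_rel X)"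
proof (rule equivI)
  show "lie_rel X \<subseteq> lterms X \<times> lterms X"
    by (auto simp: lie_rel_def dest: lie_eq_lterms)
  show "refl_on (lterms X) (lie_rel X)"
    by (simp add: refl_on_def lie_rel_def lie_eq.refl)
  show "sym_on UNIV (lie_rel X)"
    by (simp add: sym_def lie_rel_def lie_eq.sym)
  show "trans_on UNIV (lie_rel X)"
    unfolding trans_def lie_rel_def using lie_eq.trans[of X] by fast
qed

lemma lie_class_eq_iff:
  "\<lbrakk>s \<in> lterms X; t \<in> lterms X\<rbrakk> \<Longrightarrow> lie_class X s = lie_class X t \<longleftrightarrow> lie_eq X s t"
  using eq_equiv_class_iff[OF equiv_lie_rel, of s X t]
  by (simp add: lie_class_def lie_rel_def)

lemma lie_class_eqI: "lie_eq X s t \<Longrightarrow> lie_class X s = lie_class X t"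
  using lie_class_eq_iff lie_eq_lterms by blast

lemma lcarrier_free_lie: "lcarrier (free_lie X) = lie_class X ` lterms X"
  by (auto simp: free_lie_def quotient_def lie_class_def)

lemma lie_class_closed [simp]: "t \<in> lterms X \<Longrightarrow> lie_class X t \<in> lcarrier (free_lie X)"
  by (simp add: lcarrier_free_lie)

lemma lcarrier_free_lieE:
  assumes "x \<in> lcarrier (free_lie X)"
  obtains t where "t \<in> lterms X" "x = lie_class X t"
  using assms by (auto simp: lcarrier_free_lie)

lemma mem_lie_class: "s \<in> lie_class X t \<longleftrightarrow> lie_eq X t s"
  by (simp add: lie_class_def lie_rel_def)

lemma free_lie_simps:
  "lzero (free_lie X) = lie_class X Zero"
  "\<lbrakk>s \<in> lterms X; t \<in> lterms X\<rbrakk>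
    \<Longrightarrow> ladd (free_lie X) (lie_class X s) (lie_class X t) = lie_class X (Add s t)"
  "t \<in> lterms X \<Longrightarrow> lscale (free_lie X) a (lie_class X t) = lie_class X (Scale a t)"
  "\<lbrakk>s \<in> lterms X; t \<in> lterms X\<rbrakk>
    \<Longrightarrow> lbracket (free_lie X) (lie_class X s) (lie_class X t) = lie_class X (Bracket s t)"
proof -
  show "lzero (free_lie X) = lie_class X Zero" by (simp add: free_lie_def)
next
  assume st: "s \<in> lterms X" "t \<in> lterms X"
  have "lie_class X (Add s' t') = lie_class X (Add s t)"
    if "lie_eq X s s'" "lie_eq X t t'" for s' t'
    by (rule lie_class_eqI[symmetric], rule lie_eq.cong_Add) (use that in auto)
  then have "(\<Union>s'\<in>lie_class X s. \<Union>t'\<in>lie_class X t. lie_class X (Add s' t')) =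
      (\<Union>s'\<in>lie_class X s. \<Union>t'\<in>lie_class X t. lie_class X (Add s t))"
    by (simp add: mem_lie_class)
  then show "ladd (free_lie X) (lie_class X s) (lie_class X t) = lie_class X (Add s t)"
    using st lie_eq.refl[of s X] lie_eq.refl[of t X] by (auto simp: free_lie_def mem_lie_class)
  have "lie_class X (Bracket s' t') = lie_class X (Bracket s t)"
    if "lie_eq X s s'" "lie_eq X t t'" for s' t'
    by (rule lie_class_eqI[symmetric], rule lie_eq.cong_Bracket) (use that in auto)
  then have "(\<Union>s'\<in>lie_class X s. \<Union>t'\<in>lie_class X t. lie_class X (Bracket s' t')) =
      (\<Union>s'\<in>lie_class X s. \<Union>t'\<in>lie_class X t. lie_class X (Bracket s t))"
    by (simp add: mem_lie_class)
  then show "lbracket (free_lie X) (lie_class X s) (lie_class X t) = lie_class X (Bracket s t)"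
    using st lie_eq.refl[of s X] lie_eq.refl[of t X] by (auto simp: free_lie_def mem_lie_class)
next
  assume t: "t \<in> lterms X"
  have "lie_class X (Scale a t') = lie_class X (Scale a t)" if "lie_eq X t t'" for t'
    by (rule lie_class_eqI[symmetric], rule lie_eq.cong_Scale) (use that in auto)
  then have "(\<Union>t'\<in>lie_class X t. lie_class X (Scale a t')) =
      (\<Union>t'\<in>lie_class X t. lie_class X (Scale a t))"
    by (simp add: mem_lie_class)
  then show "lscale (free_lie X) a (lie_class X t) = lie_class X (Scale a t)"
    using t lie_eq.refl[of t X] by (auto simp: free_lie_def mem_lie_class)
qed

lemma lie_algebra_free_lie: "lie_algebra (free_lie X)"
proof (unfold_locales, goal_cases)
  case 1
  show ?case by (simp add: free_lie_simps)
next
  case (8 x)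
  then obtain t where t: "t \<in> lterms X" "x = lie_class X t" by (auto simp: lcarrier_free_lie)
  then have "ladd (free_lie X) x (lie_class X (Scale (-1) t)) = lzero (free_lie X)"
    by (simp add: free_lie_simps lie_class_eqI lie_eq.add_inverse)
  with t show ?case by (intro bexI) auto
qed (elim lcarrier_free_lieE; simp add: free_lie_simps lie_class_eq_iff lie_eq.add_assoc
       lie_eq.add_comm lie_eq.add_zero lie_eq.scale_add_right lie_eq.scale_add_left lie_eq.scale_scale lie_eq.scale_one
       lie_eq.bracket_add_left lie_eq.bracket_add_right lie_eq.bracket_scale_left
       lie_eq.bracket_scale_right lie_eq.bracket_self lie_eq.jacobi)+

primrec lie_eval :: "('p, 'a) lie_struct \<Rightarrow> ('v \<Rightarrow> 'a) \<Rightarrow> ('p, 'v) lterm \<Rightarrow> 'a" where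
  "lie_eval L f (Var x) = f x"
| "lie_eval L f Zero = lzero L"
| "lie_eval L f (Add s t) = ladd L (lie_eval L f s) (lie_eval L f t)"
| "lie_eval L f (Scale a t) = lscale L a (lie_eval L f t)"
| "lie_eval L f (Bracket s t) = lbracket L (lie_eval L f s) (lie_eval L f t)"

context lie_algebra
begin

lemma add_left_cancel:
  assumes "x \<in> lcarrier L" "y \<in> lcarrier L" "ladd L x y = x"
  shows "y = lzero L"
proof -
  obtain x' where x': "x' \<in> lcarrier L" "ladd L x x' = lzero L"
    using add_inverse assms(1) by blast
  have "y = ladd L (ladd L x' x) y"
    using x' assms add_zero add_comm by metis
  also have "\<dots> = ladd L x' x"
    using x' assms add_assoc by metis
  finally show ?thesis using x' assms add_comm by metis
qed

lemma scale_zero: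
  assumes "x \<in> lcarrier L"
  shows "lscale L 0 x = lzero L"
proof (rule add_left_cancel)
  show "ladd L (lscale L 0 x) (lscale L 0 x) = lscale L 0 x"
    using scale_add_left[OF assms, of 0 0] by simp
qed (use assms scale_closed in auto)

lemma add_minus: "x \<in> lcarrier L \<Longrightarrow> ladd L x (lscale L (-1) x) = lzero L"
  using scale_add_left[of x 1 "-1"] scale_zero[of x] scale_one[of x] by simp

lemma lie_eval_closed:
  "\<lbrakk>\<And>x. x \<in> X \<Longrightarrow> f x \<in> lcarrier L; t \<in> lterms X\<rbrakk> \<Longrightarrow> lie_eval L f t \<in> lcarrier L"
  by (induction t) (auto intro: zero_closed add_closed scale_closed bracket_closed)

lemma lie_eval_cong:
  assumes f: "\<And>x. x \<in> X \<Longrightarrow> f x \<in> lcarrier L" and "lie_eq X s t"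
  shows "lie_eval L f s = lie_eval L f t"
  using assms(2)
proof (induction rule: lie_eq.induct)
  case (add_comm s t)
  then show ?case
    using lie_algebra.add_comm[OF lie_algebra_axioms] lie_eval_closed[of X f] f by simp
next
  case (jacobi s t u)
  then show ?case
    using lie_algebra.jacobi[OF lie_algebra_axioms] lie_eval_closed[of X f] f by simp
qed (use f in \<open>simp_all add: lie_eval_closed[of X f] add_closed scale_closed bracket_closed
      add_assoc add_zero add_minus scale_add_right scale_add_left scale_scale scale_one
      bracket_add_left bracket_add_right bracket_scale_left bracket_scale_right bracket_self\<close>)

end

theorem free_lie_universal:
  fixes L :: "('p::field, 'a) lie_struct" and f :: "'v \<Rightarrow> 'a"
  assumes L: "lie_algebra L" and f: "\<And>x. x \<in> X \<Longrightarrow> f x \<in> lcarrier L"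
  shows "\<exists>!h. h \<in> extensional (lcarrier (free_lie X)) \<and> lie_hom (free_lie X) L h \<and>
    (\<forall>x\<in>X. h (lie_class X (Var x)) = f x)"
proof -
  interpret lie_algebra L by (rule L)
  define h where "h = (\<lambda>A\<in>lcarrier (free_lie X). lie_eval L f (SOME t. t \<in> A))"
  have h: "h (lie_class X t) = lie_eval L f t" if "t \<in> lterms X" for t
  proof -
    have "(SOME s. s \<in> lie_class X t) \<in> lie_class X t"
      by (rule someI[of _ t]) (simp add: mem_lie_class lie_eq.refl that)
    then have "lie_eval L f t = lie_eval L f (SOME s. s \<in> lie_class X t)"
      by (intro lie_eval_cong[of X f]) (auto simp: f mem_lie_class)
    with that show ?thesis by (simp add: h_def)
  qed
  show ?thesis
  proof (rule ex1I[of _ h], intro conjI ballI)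
    show "h \<in> extensional (lcarrier (free_lie X))" by (simp add: h_def)
    show "lie_hom (free_lie X) L h"
      unfolding lie_hom_def lie_ring_hom_def lcarrier_free_lie
      by (auto simp: h free_lie_simps lie_eval_closed[of X f] f)
    show "h (lie_class X (Var x)) = f x" if "x \<in> X" for x
      using that by (simp add: h)
  next
    fix g assume g: "g \<in> extensional (lcarrier (free_lie X)) \<and> lie_hom (free_lie X) L g \<and>
      (\<forall>x\<in>X. g (lie_class X (Var x)) = f x)"
    then have hom: "lie_hom (free_lie X) L g" by blast
    have add: "g (lie_class X (Add s t)) = ladd L (g (lie_class X s)) (g (lie_class X t))"
      and br: "g (lie_class X (Bracket s t)) = lbracket L (g (lie_class X s)) (g (lie_class X t))"
      if "s \<in> lterms X" "t \<in> lterms X" for s t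
      using hom that by (simp_all add: lie_hom_def lie_ring_hom_def flip: free_lie_simps)
    have sc: "g (lie_class X (Scale a t)) = lscale L a (g (lie_class X t))"
      if "t \<in> lterms X" for a t
      using hom that by (simp add: lie_hom_def flip: free_lie_simps)
    have cl: "g (lie_class X Zero) \<in> lcarrier L"
      using hom by (auto simp: lie_hom_def lie_ring_hom_def)
    have "ladd L (g (lie_class X Zero)) (g (lie_class X Zero)) = g (lie_class X Zero)"
      using add[OF lterms_simps(2) lterms_simps(2)]
        lie_class_eqI[OF lie_eq.add_zero[OF lterms_simps(2), of X]] by metis
    then have zero: "g (lie_class X Zero) = lzero L"
      using add_left_cancel cl by blast
    have "g (lie_class X t) = lie_eval L f t" if "t \<in> lterms X" for t
      using that by (induction t) (auto simp: g add br sc zero)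
    then show "g = h"
      using g h by (intro extensionalityI[of g "lcarrier (free_lie X)" h])
        (auto simp: h_def lcarrier_free_lie)
  qed
qed


section \<open>Categories and their automorphisms\<close>

record ('o, 'm) category =
  Ob :: "'o set"
  Mor :: "'m set"
  Dom :: "'m \<Rightarrow> 'o"
  Cod :: "'m \<Rightarrow> 'o"
  Ident :: "'o \<Rightarrow> 'm"
  Comp :: "'m \<Rightarrow> 'm \<Rightarrow> 'm"

definition is_category :: "('o, 'm) category \<Rightarrow> bool" where
  "is_category C \<longleftrightarrow>
     (\<forall>f\<in>Mor C. Dom C f \<in> Ob C \<and> Cod C f \<in> Ob C) \<and>
     (\<forall>A\<in>Ob C. Ident C A \<in> Mor C \<and> Dom C (Ident C A) = A \<and> Cod C (Ident C A) = A) \<and>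
     (\<forall>f\<in>Mor C. \<forall>g\<in>Mor C. Dom C g = Cod C f \<longrightarrow>
        Comp C g f \<in> Mor C \<and> Dom C (Comp C g f) = Dom C f \<and> Cod C (Comp C g f) = Cod C g) \<and>
     (\<forall>f\<in>Mor C. Comp C f (Ident C (Dom C f)) = f \<and> Comp C (Ident C (Cod C f)) f = f) \<and>
     (\<forall>f\<in>Mor C. \<forall>g\<in>Mor C. \<forall>h\<in>Mor C. Dom C g = Cod C f \<longrightarrow> Dom C h = Cod C g \<longrightarrow>
        Comp C h (Comp C g f) = Comp C (Comp C h g) f)"

definition is_functor ::
    "('o, 'm) category \<Rightarrow> ('o2, 'm2) category \<Rightarrow> ('o \<Rightarrow> 'o2) \<Rightarrow> ('m \<Rightarrow> 'm2) \<Rightarrow> bool" where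
  "is_functor C D Fo Fm \<longleftrightarrow>
     (\<forall>A\<in>Ob C. Fo A \<in> Ob D) \<and>
     (\<forall>f\<in>Mor C. Fm f \<in> Mor D \<and> Dom D (Fm f) = Fo (Dom C f) \<and> Cod D (Fm f) = Fo (Cod C f)) \<and>
     (\<forall>A\<in>Ob C. Fm (Ident C A) = Ident D (Fo A)) \<and>
     (\<forall>f\<in>Mor C. \<forall>g\<in>Mor C. Dom C g = Cod C f \<longrightarrow> Fm (Comp C g f) = Comp D (Fm g) (Fm f))"

definition category_automorphism ::
    "('o, 'm) category \<Rightarrow> ('o \<Rightarrow> 'o) \<Rightarrow> ('m \<Rightarrow> 'm) \<Rightarrow> bool" where
  "category_automorphism C Fo Fm \<longleftrightarrow> is_functor C C Fo Fm \<and>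
     (\<exists>Go Gm. is_functor C C Go Gm \<and>
        (\<forall>A\<in>Ob C. Go (Fo A) = A \<and> Fo (Go A) = A) \<and>
        (\<forall>f\<in>Mor C. Gm (Fm f) = f \<and> Fm (Gm f) = f))"


section \<open>The category of finitely generated free Lie algebras\<close>

text \<open>
  A morphism is a triple of domain, underlying map and codomain. The map is required to be
  \<^const>\<open>extensional\<close>, so that equality of morphisms is equality of maps on the carrier.
\<close>

type_synonym ('p, 'v) free_lie_mor =
  "('p, 'v) free_lie_struct \<times> (('p, 'v) lterm set \<Rightarrow> ('p, 'v) lterm set) \<times> ('p, 'v) free_lie_struct"

definition free_lie_objects :: "'v set \<Rightarrow> ('p::field, 'v) free_lie_struct set" where
  "free_lie_objects V = {free_lie X | X. finite X \<and> X \<subseteq> V}"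

definition free_lie_category ::
    "'v set \<Rightarrow> (('p::field, 'v) free_lie_struct, ('p, 'v) free_lie_mor) category" where
  "free_lie_category V =
     \<lparr>Ob = free_lie_objects V,
      Mor = {(A, h, B). A \<in> free_lie_objects V \<and> B \<in> free_lie_objects V \<and>
               h \<in> extensional (lcarrier A) \<and> lie_hom A B h},
      Dom = (\<lambda>(A, h, B). A),
      Cod = (\<lambda>(A, h, B). B),
      Ident = (\<lambda>A. (A, \<lambda>x\<in>lcarrier A. x, A)),
      Comp = (\<lambda>(B', g, C) (A, f, B). (A, compose (lcarrier A) g f, C))\<rparr>"

lemma lie_algebra_free_lie_objects: "A \<in> free_lie_objects V \<Longrightarrow> lie_algebra A"
  by (auto simp: free_lie_objects_def lie_algebra_free_lie)

lemma is_category_free_lie_category: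
  "is_category (free_lie_category V :: (('p::field, 'v) free_lie_struct, _) category)"
proof -
  have id: "lie_hom A A (\<lambda>x\<in>lcarrier A. x)" if "A \<in> free_lie_objects V"
    for A :: "('p, 'v) free_lie_struct"
  proof -
    interpret lie_algebra A using that by (rule lie_algebra_free_lie_objects)
    show ?thesis
      by (simp add: lie_hom_def lie_ring_hom_def add_closed scale_closed bracket_closed)
  qed
  have comp: "lie_hom A C (compose (lcarrier A) g f)"
    if "A \<in> free_lie_objects V" "lie_hom A B f" "lie_hom B C g"
    for A B C :: "('p, 'v) free_lie_struct" and f g
  proof -
    interpret lie_algebra A using that(1) by (rule lie_algebra_free_lie_objects)
    show ?thesis using that(2,3)
      by (simp add: lie_hom_def lie_ring_hom_def compose_def add_closed scale_closed bracket_closed)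
  qed
  have map: "h x \<in> lcarrier B" if "lie_hom A B h" "x \<in> lcarrier A"
    for A B :: "('p, 'v) free_lie_struct" and h x
    using that by (simp add: lie_hom_def lie_ring_hom_def)
  have comp_assoc: "compose (lcarrier A) h (compose (lcarrier A) g f) =
      compose (lcarrier A) (compose (lcarrier B) h g) f"
    if "lie_hom A B f" for A B :: "('p, 'v) free_lie_struct" and f g h
    using map[OF that] by (auto simp: compose_def fun_eq_iff)
  have comp_id: "compose (lcarrier A) f (\<lambda>x\<in>lcarrier A. x) = f"
    "compose (lcarrier A) (\<lambda>x\<in>lcarrier B. x) f = f"
    if "lie_hom A B f" "f \<in> extensional (lcarrier A)"
    for A B :: "('p, 'v) free_lie_struct" and f
    using map[OF that(1)] that(2) by (auto simp: compose_def fun_eq_iff extensional_def)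
  show ?thesis
    unfolding is_category_def
  proof (intro conjI)
    let ?C = "free_lie_category V :: (('p, 'v) free_lie_struct, _) category"
    show "\<forall>f\<in>Mor ?C. \<forall>g\<in>Mor ?C. Dom ?C g = Cod ?C f \<longrightarrow>
        Comp ?C g f \<in> Mor ?C \<and> Dom ?C (Comp ?C g f) = Dom ?C f \<and> Cod ?C (Comp ?C g f) = Cod ?C g"
      using comp by (auto simp: free_lie_category_def compose_extensional)
    show "\<forall>f\<in>Mor ?C. Comp ?C f (Ident ?C (Dom ?C f)) = f \<and> Comp ?C (Ident ?C (Cod ?C f)) f = f"
      using comp_id by (auto simp: free_lie_category_def)
    show "\<forall>f\<in>Mor ?C. \<forall>g\<in>Mor ?C. \<forall>h\<in>Mor ?C. Dom ?C g = Cod ?C f \<longrightarrow> Dom ?C h = Cod ?C g \<longrightarrow>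
        Comp ?C h (Comp ?C g f) = Comp ?C (Comp ?C h g) f"
      using comp_assoc by (auto simp: free_lie_category_def)
  qed (auto simp: free_lie_category_def id)
qed

end

theory Submission
  imports Defs "HOL-Computational_Algebra.Polynomial"
begin

text \<open>
  Fix an automorphism \<open>\<phi>\<close> of the category, and write \<open>F(X)\<close> for the free Lie algebra over \<open>X\<close>.

  An algebra \<open>F({x})\<close> on one generator is recognized by its endomorphism monoid, which is commutative
  and has more than one element (lemma \<open>ex_generator\<close>). Hence \<open>\<phi>(F({x0})) = F({y0})\<close> for some
  variable \<open>y0\<close>. An element \<open>a\<close> of an object \<open>A\<close> is the same thing as a homomorphism
  \<open>F({x0}) \<rightarrow> A\<close>; applying \<open>\<phi>\<close> to it gives a homomorphism \<open>F({y0}) \<rightarrow> \<phi>(A)\<close>, that is, an element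
  \<open>s A a\<close> of \<open>\<phi>(A)\<close>. The maps \<open>s A\<close> are bijections and \<open>\<phi>(h) \<circ> s A = s B \<circ> h\<close> for every
  \<open>h : A \<rightarrow> B\<close> (lemmas \<open>bij_s\<close> and \<open>s_natural\<close>), so it only remains to see how far \<open>s\<close> is from
  respecting the operations. On \<open>End(F({x0}))\<close>, which is the multiplicative monoid of the field,
  \<open>\<phi>\<close> acts by a multiplicative bijection \<open>\<sigma>\<close>, and \<open>s A (l a) = \<sigma>(l) s A a\<close>.

  Let \<open>G = F({x1, x2})\<close>, with generators \<open>e1\<close> and \<open>e2\<close>. By naturality, the elements \<open>s G e1\<close> and
  \<open>s G e2\<close> generate \<open>\<phi>(G)\<close>. Therefore, for every \<open>w\<close> in \<open>G\<close> there is \<open>W\<close> in \<open>G\<close> such that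
  \<open>s A (w(a, b)) = W(s A a, s A b)\<close> for all \<open>A\<close>, \<open>a\<close> and \<open>b\<close> (lemma \<open>ex_transported_operation\<close>).
  If \<open>w(l a, l b) = l^k w(a, b)\<close>, then, \<open>\<sigma>\<close> being multiplicative and onto, also
  \<open>W(m e1, m e2) = m^k W\<close> for all \<open>m\<close>; because the field is infinite, this forces \<open>W\<close> to be
  homogeneous of total degree \<open>k\<close> (lemma \<open>transported_homog\<close>). For \<open>w = e1 + e2\<close> this means
  \<open>W = c e1 + d e2\<close>, and putting \<open>a = 0\<close> or \<open>b = 0\<close> shows that \<open>c = d = 1\<close>: so \<open>s\<close> is additive,
  and \<open>\<sigma>\<close> is a field automorphism. For \<open>w = [e1, e2]\<close> it means \<open>W = c [e1, e2]\<close>, and \<open>c \<noteq> 0\<close>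
  because \<open>[e1, e2] \<noteq> 0\<close>. The maps \<open>c s A\<close> are then the required semi-isomorphisms.
\<close>

section \<open>Homomorphisms out of free Lie algebras\<close>

lemma lie_hom_closed: "lie_hom A B h \<Longrightarrow> x \<in> lcarrier A \<Longrightarrow> h x \<in> lcarrier B"
  and lie_hom_add: "lie_hom A B h \<Longrightarrow> x \<in> lcarrier A \<Longrightarrow> y \<in> lcarrier A \<Longrightarrow>
    h (ladd A x y) = ladd B (h x) (h y)"
  and lie_hom_bracket: "lie_hom A B h \<Longrightarrow> x \<in> lcarrier A \<Longrightarrow> y \<in> lcarrier A \<Longrightarrow>
    h (lbracket A x y) = lbracket B (h x) (h y)"
  and lie_hom_scale: "lie_hom A B h \<Longrightarrow> x \<in> lcarrier A \<Longrightarrow> h (lscale A a x) = lscale B a (h x)"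
  by (simp_all add: lie_hom_def lie_ring_hom_def)

lemma lie_hom_zero:
  assumes "lie_algebra A" "lie_algebra B" "lie_hom A B h"
  shows "h (lzero A) = lzero B"
proof -
  interpret A: lie_algebra A by fact
  interpret B: lie_algebra B by fact
  have "h (lzero A) = h (lscale A 0 (lzero A))"
    using A.scale_zero[OF A.zero_closed] by simp
  also have "\<dots> = lscale B 0 (h (lzero A))"
    by (rule lie_hom_scale[OF assms(3) A.zero_closed])
  also have "\<dots> = lzero B"
    by (rule B.scale_zero[OF lie_hom_closed[OF assms(3) A.zero_closed]])
  finally show ?thesis .
qed

lemma lie_hom_restrict:
  assumes "lie_algebra A"
  shows "lie_hom A B (restrict h (lcarrier A)) \<longleftrightarrow> lie_hom A B h"
proof -
  interpret lie_algebra A by fact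
  show ?thesis by (simp add: lie_hom_def lie_ring_hom_def add_closed scale_closed bracket_closed)
qed

lemma lie_hom_comp: "lie_hom A B f \<Longrightarrow> lie_hom B C g \<Longrightarrow> lie_hom A C (g \<circ> f)"
  by (simp add: lie_hom_def lie_ring_hom_def)

lemma lie_hom_compose:
  "lie_algebra A \<Longrightarrow> lie_hom A B f \<Longrightarrow> lie_hom B C g \<Longrightarrow> lie_hom A C (compose (lcarrier A) g f)"
  using lie_hom_restrict[of A C "g \<circ> f"] lie_hom_comp[of A B f C g] by (simp add: compose_def o_def)

lemma lie_hom_id: "lie_algebra A \<Longrightarrow> lie_hom A A (\<lambda>x\<in>lcarrier A. x)"
  by (subst lie_hom_restrict) (simp_all add: lie_hom_def lie_ring_hom_def)

text \<open>The homomorphisms from \<open>A\<close> to \<open>B\<close>, normalized to be extensional so that they are the morphisms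
  of the category.\<close>

definition lie_homs :: "('p, 'a) lie_struct \<Rightarrow> ('p, 'b) lie_struct \<Rightarrow> ('a \<Rightarrow> 'b) set" where
  "lie_homs A B = {h \<in> extensional (lcarrier A). lie_hom A B h}"

text \<open>The homomorphism from the free algebra over \<open>X\<close> to \<open>L\<close> that maps each variable \<open>x\<close> to \<open>f x\<close>.\<close>

definition free_lift ::
    "'v set \<Rightarrow> ('p::field, 'a) lie_struct \<Rightarrow> ('v \<Rightarrow> 'a) \<Rightarrow> ('p, 'v) lterm set \<Rightarrow> 'a" where
  "free_lift X L f = (THE h. h \<in> extensional (lcarrier (free_lie X)) \<and> lie_hom (free_lie X) L h \<and>
    (\<forall>x\<in>X. h (lie_class X (Var x)) = f x))"

lemma
  fixes L :: "('p::field, 'a) lie_struct"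
  assumes "lie_algebra L" and "\<And>x. x \<in> X \<Longrightarrow> f x \<in> lcarrier L"
  shows free_lift_in_homs: "free_lift X L f \<in> lie_homs (free_lie X) L"
    and free_lift_hom: "lie_hom (free_lie X) L (free_lift X L f)"
    and free_lift_Var: "x \<in> X \<Longrightarrow> free_lift X L f (lie_class X (Var x)) = f x"
  using theI'[OF free_lie_universal[where X = X and f = f, OF assms], folded free_lift_def] by (auto simp: lie_homs_def)

lemma free_lie_hom_eqI:
  fixes L :: "('p::field, 'a) lie_struct"
  assumes L: "lie_algebra L" and g: "lie_hom (free_lie X) L g" and h: "lie_hom (free_lie X) L h"
    and eq: "\<And>x. x \<in> X \<Longrightarrow> g (lie_class X (Var x)) = h (lie_class X (Var x))"
    and a: "a \<in> lcarrier (free_lie X)"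
  shows "g a = h a"
proof -
  let ?F = "free_lie X"
  have cl: "\<And>x. x \<in> X \<Longrightarrow> g (lie_class X (Var x)) \<in> lcarrier L"
    using lie_hom_closed[OF g] by simp
  note unique = the1_equality[OF free_lie_universal[where X = X and f = "\<lambda>x. g (lie_class X (Var x))", OF L cl]]
  have "restrict g (lcarrier ?F) = restrict h (lcarrier ?F)"
    by (rule HOL.trans[OF unique[symmetric] unique])
      (simp_all add: lie_hom_restrict[OF lie_algebra_free_lie] g h eq)
  then show ?thesis using a by (metis restrict_apply')
qed

lemma lie_eval_Var:
  fixes X :: "'v set"
  assumes "t \<in> lterms X"
  shows "lie_eval (free_lie X :: ('p::field, 'v) free_lie_struct) (\<lambda>x. lie_class X (Var x)) t = lie_class X t"
  using assms by (induction t) (simp_all add: free_lie_simps)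


section \<open>Homogeneous elements\<close>

context lie_algebra
begin

lemma add_swap4:
  assumes "a \<in> lcarrier L" "b \<in> lcarrier L" "c \<in> lcarrier L" "d \<in> lcarrier L"
  shows "ladd L (ladd L a b) (ladd L c d) = ladd L (ladd L a c) (ladd L b d)"
  using assms by (metis add_assoc add_comm add_closed)

lemma add_zero_right: "x \<in> lcarrier L \<Longrightarrow> ladd L x (lzero L) = x"
  using add_zero add_comm zero_closed by metis

lemma scale_zero_right: "lscale L a (lzero L) = lzero L"
  using scale_zero[OF zero_closed] scale_scale[OF zero_closed, of a 0] by simp

lemma bracket_zero_left: "x \<in> lcarrier L \<Longrightarrow> lbracket L (lzero L) x = lzero L"
  using bracket_scale_left[OF zero_closed, of x 0] scale_zero[OF zero_closed]
    scale_zero[OF bracket_closed[OF zero_closed]] by metis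

lemma bracket_zero_right: "x \<in> lcarrier L \<Longrightarrow> lbracket L x (lzero L) = lzero L"
  using bracket_scale_right[OF _ zero_closed, of x 0] scale_zero[OF zero_closed]
    scale_zero[OF bracket_closed[OF _ zero_closed]] by metis

lemma bracket_anticomm:
  assumes x: "x \<in> lcarrier L" and y: "y \<in> lcarrier L"
  shows "lbracket L y x = lscale L (-1) (lbracket L x y)"
proof -
  let ?p = "lbracket L x y" and ?q = "lbracket L y x" and ?m = "lscale L (-1) (lbracket L x y)"
  have cl: "?p \<in> lcarrier L" "?q \<in> lcarrier L" "?m \<in> lcarrier L"
    using x y by (simp_all add: bracket_closed scale_closed)
  have "lzero L = lbracket L (ladd L x y) (ladd L x y)"
    using x y by (simp add: bracket_self add_closed)
  also have "\<dots> = ladd L (ladd L (lbracket L x x) ?q) (ladd L ?p (lbracket L y y))"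
    using x y by (simp add: bracket_add_left bracket_add_right add_closed)
  also have "\<dots> = ladd L ?q ?p"
    using x y cl by (simp add: bracket_self add_zero add_zero_right)
  finally have "ladd L ?q ?p = lzero L" by simp
  then have "?m = ladd L (ladd L ?q ?p) ?m" using cl by (simp add: add_zero)
  also have "\<dots> = ladd L ?q (ladd L ?p ?m)" using cl by (simp add: add_assoc)
  also have "\<dots> = ?q" using cl by (simp add: add_minus add_zero_right)
  finally show ?thesis by simp
qed

lemma scale_eq_zero:
  assumes "x \<in> lcarrier L" "lscale L a x = lzero L" "x \<noteq> lzero L"
  shows "a = 0"
proof (rule ccontr)
  assume "a \<noteq> 0"
  then have "x = lscale L (inverse a) (lscale L a x)"
    using assms(1) by (simp add: scale_one flip: scale_scale)
  with assms scale_zero_right show False by simp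
qed

lemma scale_eq_scale:
  assumes "x \<in> lcarrier L" "lscale L a x = lscale L b x" "x \<noteq> lzero L"
  shows "a = b"
proof -
  have "lscale L (a - b) x = ladd L (lscale L a x) (lscale L (- b) x)"
    using scale_add_left[OF assms(1), of a "- b"] by simp
  also have "\<dots> = lscale L (b + - b) x" using assms by (simp only: scale_add_left)
  also have "\<dots> = lzero L" using assms by (simp add: scale_zero)
  finally show ?thesis using scale_eq_zero[OF assms(1) _ assms(3)] by force
qed

end

text \<open>\<open>homog L B n u\<close>: the element \<open>u\<close> is a linear combination of brackets, nested in any way, of \<open>n\<close>
  elements of \<open>B\<close>. \<open>homog_sum L B ns u\<close>: \<open>u\<close> is a sum of homogeneous elements whose degrees, not
  necessarily distinct, are listed in \<open>ns\<close>. No uniqueness of the decomposition is claimed, so \<open>L\<close>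
  need not be graded.\<close>

inductive homog :: "('p, 'a) lie_struct \<Rightarrow> 'a set \<Rightarrow> nat \<Rightarrow> 'a \<Rightarrow> bool" for L B where
  gen: "b \<in> B \<Longrightarrow> homog L B 1 b"
| zero: "homog L B n (lzero L)"
| add: "\<lbrakk>homog L B n u; homog L B n v\<rbrakk> \<Longrightarrow> homog L B n (ladd L u v)"
| scale: "homog L B n u \<Longrightarrow> homog L B n (lscale L a u)"
| bracket: "\<lbrakk>homog L B i u; homog L B j v\<rbrakk> \<Longrightarrow> homog L B (i + j) (lbracket L u v)"

inductive homog_sum :: "('p, 'a) lie_struct \<Rightarrow> 'a set \<Rightarrow> nat list \<Rightarrow> 'a \<Rightarrow> bool" for L B where
  Nil: "homog_sum L B [] (lzero L)"
| Cons: "\<lbrakk>homog L B n u; homog_sum L B ns v\<rbrakk> \<Longrightarrow> homog_sum L B (n # ns) (ladd L u v)"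

inductive_cases homog_sum_ConsE: "homog_sum L B (n # ns) u"
inductive_cases homog_sum_NilE: "homog_sum L B [] u"

lemma finite_power_eq:
  fixes k n :: nat
  assumes "n \<noteq> k"
  shows "finite {x::'p::field. x ^ n = x ^ k}"
proof -
  let ?q = "monom (1::'p) n - monom 1 k"
  have "coeff ?q n = 1" using assms by simp
  then have "?q \<noteq> 0" by (metis coeff_0 zero_neq_one)
  then have "finite {x. poly ?q x = 0}" by (rule poly_roots_finite)
  then show ?thesis by (simp add: poly_monom)
qed

lemma ex_distinct_powers:
  assumes "infinite (UNIV :: 'p::field set)"
  obtains l :: "'p::field" where "\<And>n. n \<in> set ns \<Longrightarrow> n \<noteq> k \<Longrightarrow> l ^ n \<noteq> l ^ k"
proof -
  have "finite (\<Union>n\<in>set ns - {k}. {x::'p. x ^ n = x ^ k})"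
    by (intro finite_UN_I) (auto simp: finite_power_eq)
  then obtain l where "l \<notin> (\<Union>n\<in>set ns - {k}. {x::'p. x ^ n = x ^ k})"
    using assms by (metis ex_new_if_finite)
  then show thesis by (intro that[of l]) auto
qed

context lie_algebra
begin

context
  fixes B :: "'a set"
  assumes B: "B \<subseteq> lcarrier L"
begin

lemma homog_closed: "homog L B n u \<Longrightarrow> u \<in> lcarrier L"
  by (induction rule: homog.induct)
    (use B in \<open>auto simp: zero_closed add_closed scale_closed bracket_closed\<close>)

lemma homog_sum_closed: "homog_sum L B ns u \<Longrightarrow> u \<in> lcarrier L"
  by (induction rule: homog_sum.induct) (auto simp: zero_closed add_closed homog_closed)

lemma homog_sum_append:
  "homog_sum L B ns u \<Longrightarrow> homog_sum L B ms v \<Longrightarrow> homog_sum L B (ns @ ms) (ladd L u v)"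
proof (induction rule: homog_sum.induct)
  case (Cons n u ns u')
  then have "homog_sum L B (n # ns @ ms) (ladd L u (ladd L u' v))"
    by (intro homog_sum.Cons) auto
  with Cons show ?case by (simp add: add_assoc homog_closed homog_sum_closed)
qed (simp add: add_zero homog_sum_closed)

lemma homog_sum_single: "homog L B n u \<Longrightarrow> homog_sum L B [n] u"
  using homog_sum.Cons[OF _ homog_sum.Nil, of L B n u] by (simp add: add_zero_right homog_closed)

lemma homog_sum_scale: "homog_sum L B ns u \<Longrightarrow> homog_sum L B ns (lscale L a u)"
  by (induction rule: homog_sum.induct)
    (auto simp: scale_zero_right scale_add_right homog_closed homog_sum_closed
      intro!: homog_sum.intros homog.scale)

lemma homog_sum_bracket_homog:
  assumes "homog L B i u"
  shows "homog_sum L B ns v \<Longrightarrow> homog_sum L B (map ((+) i) ns) (lbracket L u v)"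
  by (induction rule: homog_sum.induct)
    (use assms in \<open>auto simp: bracket_zero_right bracket_add_right homog_closed homog_sum_closed
      intro!: homog_sum.intros homog.bracket\<close>)

lemma homog_sum_bracket:
  assumes "homog_sum L B ms v"
  shows "homog_sum L B ns u \<Longrightarrow> \<exists>ks. homog_sum L B ks (lbracket L u v)"
proof (induction rule: homog_sum.induct)
  case Nil
  then show ?case
    using assms by (auto simp: bracket_zero_left homog_sum_closed intro: homog_sum.Nil)
next
  case (Cons n u ns u')
  then obtain ks where "homog_sum L B ks (lbracket L u' v)" by blast
  then have "homog_sum L B (map ((+) n) ms @ ks) (ladd L (lbracket L u v) (lbracket L u' v))"
    by (intro homog_sum_append homog_sum_bracket_homog Cons assms)
  with Cons assms show ?case by (auto simp: bracket_add_left homog_closed homog_sum_closed)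
qed

lemma ex_homog_sum:
  assumes "f ` X \<subseteq> B" "t \<in> lterms X"
  shows "\<exists>ns. homog_sum L B ns (lie_eval L f t)"
  using assms(2)
proof (induction t)
  case (Var x)
  then have "f x \<in> B" using assms(1) by auto
  then have "homog_sum L B [1] (f x)" by (intro homog_sum_single homog.gen)
  then show ?case by auto
next
  case Zero
  then show ?case by (auto intro: homog_sum.Nil)
next
  case (Add s t)
  then show ?case by (auto intro: homog_sum_append)
next
  case (Scale a t)
  then show ?case by (auto intro: homog_sum_scale)
next
  case (Bracket s t)
  then show ?case by (auto intro: homog_sum_bracket)
qed

text \<open>A homomorphism that multiplies the generators by \<open>l\<close> has the homogeneous elements of degree
  \<open>n\<close> as eigenvectors for \<open>l ^ n\<close>.\<close>

lemma homog_eigenvector: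
  assumes "lie_hom L L d" and "\<And>b. b \<in> B \<Longrightarrow> d b = lscale L l b"
  shows "homog L B n u \<Longrightarrow> d u = lscale L (l ^ n) u"
proof (induction rule: homog.induct)
  case (zero n)
  show ?case
    by (simp add: lie_hom_zero[OF lie_algebra_axioms lie_algebra_axioms assms(1)] scale_zero_right)
next
  case (scale n u a)
  then show ?case
    by (simp add: lie_hom_scale[OF assms(1)] homog_closed mult.commute flip: scale_scale)
next
  case (bracket i u j v)
  then show ?case
    by (simp add: lie_hom_bracket[OF assms(1)] homog_closed bracket_scale_left bracket_scale_right
        scale_closed bracket_closed power_add mult.commute flip: scale_scale)
qed (use assms in \<open>simp_all add: lie_hom_add[OF assms(1)] homog_closed scale_add_right\<close>)

text \<open>The converse for one element \<open>u\<close>, decomposed as \<open>h + w\<close>. The summands of \<open>w\<close> are removed or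
  absorbed one at a time: one of degree \<open>k\<close> is added to \<open>h\<close>; for one of degree \<open>n \<noteq> k\<close>, the linear
  operator \<open>T = a d + b\<close> with suitable \<open>a\<close> and \<open>b\<close> annihilates it and fixes the
  \<open>l ^ k\<close>-eigenvectors of \<open>d\<close>, so that applying \<open>T\<close> to \<open>u\<close> gives a shorter decomposition of the
  same element.\<close>

lemma eigenvector_homog:
  assumes d: "lie_hom L L d" and dB: "\<And>b. b \<in> B \<Longrightarrow> d b = lscale L l b"
    and u: "u \<in> lcarrier L" "d u = lscale L (l ^ k) u"
    and h: "homog L B k h" and w: "homog_sum L B ns w" and uhw: "u = ladd L h w"
    and l: "\<And>n. n \<in> set ns \<Longrightarrow> n \<noteq> k \<Longrightarrow> l ^ n \<noteq> l ^ k"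
  shows "homog L B k u"
  using h w uhw l
proof (induction ns arbitrary: h w)
  case Nil
  then show ?case by (auto elim!: homog_sum_NilE simp: add_zero_right homog_closed)
next
  case (Cons n ns)
  from \<open>homog_sum L B (n # ns) w\<close> obtain v w' where
    v: "homog L B n v" and w': "homog_sum L B ns w'" and w: "w = ladd L v w'"
    by (auto elim: homog_sum_ConsE)
  have cl: "h \<in> lcarrier L" "v \<in> lcarrier L" "w' \<in> lcarrier L"
    using Cons.prems(1) v w' by (auto simp: homog_closed homog_sum_closed)
  show ?case
  proof (cases "n = k")
    case True
    have "u = ladd L (ladd L h v) w'"
      using cl w Cons.prems(3) by (simp add: add_assoc)
    moreover have "homog L B k (ladd L h v)"
      using True v Cons.prems(1) by (auto intro: homog.add)
    ultimately show ?thesis using Cons.IH[OF _ w'] Cons.prems(4) by auto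
  next
    case False
    then have ne: "l ^ k - l ^ n \<noteq> 0" using Cons.prems(4)[of n] by auto
    \<comment> \<open>chosen so that \<open>a l^k + b = 1\<close> and \<open>a l^n + b = 0\<close>\<close>
    define a where "a = inverse (l ^ k - l ^ n)"
    define b where "b = - a * l ^ n"
    define T where "T z = ladd L (lscale L a (d z)) (lscale L b z)" for z
    have d_cl: "\<And>z. z \<in> lcarrier L \<Longrightarrow> d z \<in> lcarrier L" using lie_hom_closed[OF d] .
    have T_cl: "\<And>z. z \<in> lcarrier L \<Longrightarrow> T z \<in> lcarrier L"
      by (simp add: T_def add_closed scale_closed d_cl)
    have T_add: "T (ladd L y z) = ladd L (T y) (T z)"
      if "y \<in> lcarrier L" "z \<in> lcarrier L" for y z
      using that by (simp add: T_def lie_hom_add[OF d] scale_add_right d_cl scale_closed add_swap4)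
    have T_eig: "T z = lscale L (a * l ^ m + b) z"
      if "z \<in> lcarrier L" "d z = lscale L (l ^ m) z" for z m
      using that by (simp add: T_def scale_add_left scale_scale)
    have one: "a * l ^ k + b = 1"
      using ne by (simp add: a_def b_def flip: right_diff_distrib)
    have "u = T u" using T_eig[OF u] u(1) by (simp add: one scale_one)
    also have "\<dots> = ladd L (T h) (ladd L (T v) (T w'))"
      using Cons.prems(3) w cl by (simp add: T_add add_closed)
    also have "T h = h"
      using T_eig[OF cl(1) homog_eigenvector[OF d dB Cons.prems(1)]] cl by (simp add: one scale_one)
    also have "T v = lzero L"
      using T_eig[OF cl(2) homog_eigenvector[OF d dB v]] cl by (simp add: b_def scale_zero)
    also have "ladd L (lzero L) (T w') = T w'" using T_cl cl by (simp add: add_zero)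
    finally have "u = ladd L h (T w')" .
    moreover have "homog_sum L B ns (T w')"
      using w'
    proof (induction rule: homog_sum.induct)
      case Nil
      have "T (lzero L) = lzero L"
        using lie_hom_zero[OF lie_algebra_axioms lie_algebra_axioms d] zero_closed
        by (simp add: T_def scale_zero_right add_zero)
      then show ?case by (simp add: homog_sum.Nil)
    next
      case (Cons m y ns z)
      then have "homog L B m (T y)"
        by (simp add: T_eig[OF homog_closed homog_eigenvector[OF d dB]] homog.scale)
      with Cons show ?case
        by (simp add: T_add homog_closed homog_sum_closed homog_sum.Cons)
    qed
    ultimately show ?thesis using Cons.IH Cons.prems(1,4) by auto
  qed
qed

end

lemma homog_0: "B \<subseteq> lcarrier L \<Longrightarrow> homog L B n u \<Longrightarrow> n = 0 \<Longrightarrow> u = lzero L"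
proof (rotate_tac, induction rule: homog.induct)
  case (bracket i u j v)
  then show ?case by (simp add: bracket_zero_left zero_closed)
qed (auto simp: add_zero zero_closed scale_zero_right)

lemma homog_1:
  assumes x: "x \<in> lcarrier L" and y: "y \<in> lcarrier L"
  shows "homog L {x, y} n u \<Longrightarrow> n = 1 \<Longrightarrow> \<exists>a b. u = ladd L (lscale L a x) (lscale L b y)"
proof (induction rule: homog.induct)
  case (gen b)
  have "x = ladd L (lscale L 1 x) (lscale L 0 y)" "y = ladd L (lscale L 0 x) (lscale L 1 y)"
    using x y by (simp_all add: scale_one scale_zero add_zero add_zero_right)
  with gen show ?case by blast
next
  case (zero n)
  have "lzero L = ladd L (lscale L 0 x) (lscale L 0 y)"
    using x y by (simp add: scale_zero add_zero zero_closed)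
  then show ?case by blast
next
  case (add n u v)
  then obtain a b a' b' where "u = ladd L (lscale L a x) (lscale L b y)"
    "v = ladd L (lscale L a' x) (lscale L b' y)" by blast
  then have "ladd L u v = ladd L (lscale L (a + a') x) (lscale L (b + b') y)"
    using x y by (simp add: add_swap4 scale_closed scale_add_left)
  then show ?case by blast
next
  case (scale n u c)
  then obtain a b where "u = ladd L (lscale L a x) (lscale L b y)" by blast
  then have "lscale L c u = ladd L (lscale L (c * a) x) (lscale L (c * b) y)"
    using x y by (simp add: scale_closed scale_add_right scale_scale)
  then show ?case by blast
next
  case (bracket i u j v)
  have B: "{x, y} \<subseteq> lcarrier L" using x y by simp
  have uv: "u \<in> lcarrier L" "v \<in> lcarrier L" using bracket.hyps homog_closed[OF B] by auto
  have "i = 0 \<or> j = 0" using bracket.prems by auto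
  then have "u = lzero L \<or> v = lzero L" using bracket.hyps homog_0[OF B] by blast
  then have "lbracket L u v = lzero L" using uv by (auto simp: bracket_zero_left bracket_zero_right)
  also have "lzero L = ladd L (lscale L 0 x) (lscale L 0 y)"
    using x y by (simp add: scale_zero add_zero zero_closed)
  finally show ?case by blast
qed

text \<open>In degree two the brackets \<open>[x, x]\<close> and \<open>[y, y]\<close> vanish and \<open>[y, x] = - [x, y]\<close>.\<close>

lemma homog_2:
  assumes x: "x \<in> lcarrier L" and y: "y \<in> lcarrier L"
  shows "homog L {x, y} n u \<Longrightarrow> n = 2 \<Longrightarrow> \<exists>c. u = lscale L c (lbracket L x y)"
proof (induction rule: homog.induct)
  case (zero n)
  show ?case using scale_zero[OF bracket_closed[OF x y]] by metis
next
  case (add n u v)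
  then show ?case by (metis scale_add_left bracket_closed x y)
next
  case (scale n u a)
  then show ?case by (metis scale_scale bracket_closed x y)
next
  case (bracket i u j v)
  have B: "{x, y} \<subseteq> lcarrier L" using x y by simp
  have uv: "u \<in> lcarrier L" "v \<in> lcarrier L" using bracket.hyps homog_closed[OF B] by auto
  consider "i = 0 \<or> j = 0" | "i = 1" "j = 1" using bracket.prems by linarith
  then show ?case
  proof cases
    case 1
    then have "u = lzero L \<or> v = lzero L" using bracket.hyps homog_0[OF B] by blast
    then have "lbracket L u v = lscale L 0 (lbracket L x y)"
      using uv x y by (auto simp: bracket_zero_left bracket_zero_right scale_zero bracket_closed)
    then show ?thesis by blast
  next
    case 2
    then obtain a b a' b' where u: "u = ladd L (lscale L a x) (lscale L b y)"
      and v: "v = ladd L (lscale L a' x) (lscale L b' y)"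
      using bracket.hyps homog_1[OF x y] by blast
    have "lbracket L u v = ladd L (lscale L (a' * b) (lbracket L y x))
        (lscale L (b' * a) (lbracket L x y))"
      using x y by (simp add: u v bracket_add_left bracket_add_right add_closed scale_closed
          bracket_scale_left bracket_scale_right bracket_self scale_zero_right add_zero
          add_zero_right bracket_closed scale_scale zero_closed)
    also have "\<dots> = lscale L (a' * b * (- 1) + b' * a) (lbracket L x y)"
      using x y bracket_anticomm[OF x y]
      by (simp only: scale_add_left scale_scale bracket_closed)
    finally show ?thesis by blast
  qed
qed simp

end


section \<open>Generators of free Lie algebras\<close>

text \<open>The Lie algebra with basis \<open>e = (1, 0)\<close>, \<open>f = (0, 1)\<close> and \<open>[e, f] = f\<close>. Mapping generators to
  \<open>e\<close> or \<open>f\<close> shows that generators are distinct and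
  nonzero and that two generators do not commute.\<close>

definition affine_lie :: "('p::field, 'p \<times> 'p) lie_struct" where
  "affine_lie =
     \<lparr>lcarrier = UNIV, lzero = (0, 0),
      ladd = (\<lambda>(a, b) (c, d). (a + c, b + d)),
      lscale = (\<lambda>r (a, b). (r * a, r * b)),
      lbracket = (\<lambda>(a, b) (c, d). (0, a * d - b * c))\<rparr>"

lemma lie_algebra_affine_lie: "lie_algebra affine_lie"
proof (unfold_locales, goal_cases)
  case (8 x)
  show ?case
    by (rule bexI[of _ "(- fst x, - snd x)"]) (simp_all add: affine_lie_def case_prod_beta)
qed (simp_all add: affine_lie_def case_prod_beta prod_eq_iff algebra_simps)

text \<open>The generator of the free Lie algebra over \<open>X\<close> given by the variable \<open>x\<close>.\<close>

abbreviation gen :: "'v set \<Rightarrow> 'v \<Rightarrow> ('p::field, 'v) lterm set" where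
  "gen X x \<equiv> lie_class X (Var x)"

lemma free_lie_separated:
  fixes f :: "'v \<Rightarrow> 'p::field \<times> 'p"
  obtains h :: "('p, 'v) lterm set \<Rightarrow> 'p \<times> 'p"
  where "lie_hom (free_lie X) affine_lie h" "\<And>x. x \<in> X \<Longrightarrow> h (gen X x) = f x"
  using free_lift_hom[OF lie_algebra_affine_lie, of X f] free_lift_Var[OF lie_algebra_affine_lie, of X f]
  by (auto simp: affine_lie_def)

lemma gen_neq_zero:
  assumes "x \<in> X"
  shows "(gen X x :: ('p::field, 'v) lterm set) \<noteq> lzero (free_lie X)"
proof
  assume eq: "(gen X x :: ('p::field, 'v) lterm set) = lzero (free_lie X)"
  obtain h :: "('p, 'v) lterm set \<Rightarrow> 'p \<times> 'p"
    where h: "lie_hom (free_lie X) affine_lie h" and hv: "\<And>x. x \<in> X \<Longrightarrow> h (gen X x) = (1, 0)"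
    by (rule free_lie_separated[where X = X and f = "\<lambda>_. (1, 0)"]) blast
  show False
    using hv[OF assms] lie_hom_zero[OF lie_algebra_free_lie lie_algebra_affine_lie h] eq
    by (simp add: affine_lie_def)
qed

lemma
  assumes x: "x \<in> X" and y: "y \<in> X" and "x \<noteq> y"
  shows gen_neq: "(gen X x :: ('p::field, 'v) lterm set) \<noteq> gen X y"
    and gen_bracket_neq_zero:
      "lbracket (free_lie X) (gen X x :: ('p, 'v) lterm set) (gen X y) \<noteq> lzero (free_lie X)"
proof -
  obtain h :: "('p, 'v) lterm set \<Rightarrow> 'p \<times> 'p" where h: "lie_hom (free_lie X) affine_lie h"
    and hv: "\<And>z. z \<in> X \<Longrightarrow> h (gen X z) = (if z = x then (1, 0) else (0, 1))"
    by (rule free_lie_separated[where X = X and f = "\<lambda>z. if z = x then (1, 0) else (0, 1)"]) blast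
  show "(gen X x :: ('p, 'v) lterm set) \<noteq> gen X y"
    using hv[OF x] hv[OF y] \<open>x \<noteq> y\<close> by auto
  have "h (lbracket (free_lie X) (gen X x) (gen X y)) = (0, 1)"
    using lie_hom_bracket[OF h, of "gen X x" "gen X y"] x y \<open>x \<noteq> y\<close>
    by (simp add: hv) (simp add: affine_lie_def)
  then show "lbracket (free_lie X) (gen X x :: ('p, 'v) lterm set) (gen X y) \<noteq> lzero (free_lie X)"
    using lie_hom_zero[OF lie_algebra_free_lie lie_algebra_affine_lie h]
    by (auto simp: affine_lie_def)
qed

text \<open>The free Lie algebra on one generator is spanned by it.\<close>

lemma free_lie_singleton:
  assumes "a \<in> lcarrier (free_lie {x})"
  obtains l where "a = lscale (free_lie {x}) l (gen {x} x)"
proof -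
  let ?F = "free_lie {x}" and ?g = "gen {x} x"
  interpret F: lie_algebra ?F by (rule lie_algebra_free_lie)
  have g: "?g \<in> lcarrier ?F" by simp
  obtain t where t: "t \<in> lterms {x}" "a = lie_class {x} t" using assms by (rule lcarrier_free_lieE)
  from t(1) have "\<exists>l. lie_class {x} t = lscale ?F l ?g"
  proof (induction t)
    case (Var y)
    then show ?case using F.scale_one[OF g] by (metis lterms_simps(1) singletonD)
  next
    case Zero
    show ?case using F.scale_zero[OF g] by (metis free_lie_simps(1))
  next
    case (Add s t)
    then obtain l m where "lie_class {x} s = lscale ?F l ?g" "lie_class {x} t = lscale ?F m ?g"
      by auto
    then have "lie_class {x} (Add s t) = lscale ?F (l + m) ?g"
      using Add.prems g by (simp add: F.scale_add_left flip: free_lie_simps(2))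
    then show ?case by blast
  next
    case (Scale b t)
    then obtain l where "lie_class {x} t = lscale ?F l ?g" by auto
    then have "lie_class {x} (Scale b t) = lscale ?F (b * l) ?g"
      using Scale.prems g by (simp add: F.scale_scale flip: free_lie_simps(3))
    then show ?case by blast
  next
    case (Bracket s t)
    then obtain l m where "lie_class {x} s = lscale ?F l ?g" "lie_class {x} t = lscale ?F m ?g"
      by auto
    then have "lie_class {x} (Bracket s t) = lzero ?F"
      using Bracket.prems g by (simp add: F.bracket_scale_left F.bracket_scale_right
          F.scale_closed F.bracket_self F.scale_zero_right flip: free_lie_simps(4))
    then show ?case using F.scale_zero[OF g] by metis
  qed
  then show thesis using t that by blast
qed


section \<open>Automorphisms of the category of free Lie algebras\<close>

locale free_lie_automorphism =
  fixes V :: "'v set"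
    and \<phi>o :: "('p::field, 'v) free_lie_struct \<Rightarrow> ('p, 'v) free_lie_struct"
    and \<phi>m :: "('p, 'v) free_lie_mor \<Rightarrow> ('p, 'v) free_lie_mor"
  assumes infinite_field: "infinite (UNIV :: 'p set)"
    and automorphism: "category_automorphism (free_lie_category V) \<phi>o \<phi>m"
begin

abbreviation obs :: "('p, 'v) free_lie_struct set" where "obs \<equiv> free_lie_objects V"

text \<open>The action on underlying maps: \<open>\<Phi> A B h\<close> is the map that underlies the image of the morphism
  \<open>h\<close> from \<open>A\<close> to \<open>B\<close>.\<close>

definition \<Phi> :: "('p, 'v) free_lie_struct \<Rightarrow> ('p, 'v) free_lie_struct \<Rightarrow>
    (('p, 'v) lterm set \<Rightarrow> ('p, 'v) lterm set) \<Rightarrow> ('p, 'v) lterm set \<Rightarrow> ('p, 'v) lterm set" where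
  "\<Phi> A B h = fst (snd (\<phi>m (A, h, B)))"

abbreviation \<C> :: "(('p, 'v) free_lie_struct, ('p, 'v) free_lie_mor) category" where
  "\<C> \<equiv> free_lie_category V"

lemma cat_simps:
  "Ob \<C> = obs" "Dom \<C> (A, h, B) = A" "Cod \<C> (A, h, B) = B"
  "Ident \<C> A = (A, \<lambda>x\<in>lcarrier A. x, A)"
  "Comp \<C> (B', g, C) (A, f, B) = (A, compose (lcarrier A) g f, C)"
  by (simp_all add: free_lie_category_def)

lemma Mor_iff: "(A, h, B) \<in> Mor \<C> \<longleftrightarrow> A \<in> obs \<and> B \<in> obs \<and> h \<in> lie_homs A B"
  by (auto simp: free_lie_category_def lie_homs_def)

lemma
  shows obj: "A \<in> obs \<Longrightarrow> \<phi>o A \<in> obs"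
    and \<phi>m_Mor: "f \<in> Mor \<C> \<Longrightarrow>
      \<phi>m f \<in> Mor \<C> \<and> Dom \<C> (\<phi>m f) = \<phi>o (Dom \<C> f) \<and> Cod \<C> (\<phi>m f) = \<phi>o (Cod \<C> f)"
    and \<phi>m_Ident: "A \<in> obs \<Longrightarrow> \<phi>m (Ident \<C> A) = Ident \<C> (\<phi>o A)"
    and \<phi>m_Comp: "\<lbrakk>f \<in> Mor \<C>; g \<in> Mor \<C>; Dom \<C> g = Cod \<C> f\<rbrakk> \<Longrightarrow>
      \<phi>m (Comp \<C> g f) = Comp \<C> (\<phi>m g) (\<phi>m f)"
proof -
  have "is_functor \<C> \<C> \<phi>o \<phi>m" using automorphism by (simp add: category_automorphism_def)
  note functor_parts = this[unfolded is_functor_def cat_simps(1)]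
  show "A \<in> obs \<Longrightarrow> \<phi>o A \<in> obs"
    using functor_parts by blast
  show "f \<in> Mor \<C> \<Longrightarrow>
      \<phi>m f \<in> Mor \<C> \<and> Dom \<C> (\<phi>m f) = \<phi>o (Dom \<C> f) \<and> Cod \<C> (\<phi>m f) = \<phi>o (Cod \<C> f)"
    using functor_parts by blast
  show "A \<in> obs \<Longrightarrow> \<phi>m (Ident \<C> A) = Ident \<C> (\<phi>o A)"
    using functor_parts by blast
  show "\<lbrakk>f \<in> Mor \<C>; g \<in> Mor \<C>; Dom \<C> g = Cod \<C> f\<rbrakk> \<Longrightarrow>
      \<phi>m (Comp \<C> g f) = Comp \<C> (\<phi>m g) (\<phi>m f)"
    using functor_parts by blast
qed

lemma
  assumes "A \<in> obs" "B \<in> obs" "h \<in> lie_homs A B"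
  shows \<phi>m_eq: "\<phi>m (A, h, B) = (\<phi>o A, \<Phi> A B h, \<phi>o B)"
    and \<Phi>_in: "\<Phi> A B h \<in> lie_homs (\<phi>o A) (\<phi>o B)"
proof -
  obtain A' h' B' where m: "\<phi>m (A, h, B) = (A', h', B')" by (cases "\<phi>m (A, h, B)")
  have "(A, h, B) \<in> Mor \<C>" using assms by (simp add: Mor_iff)
  from \<phi>m_Mor[OF this] m have "(A', h', B') \<in> Mor \<C>" "A' = \<phi>o A" "B' = \<phi>o B"
    by (auto simp: cat_simps)
  with m show "\<phi>m (A, h, B) = (\<phi>o A, \<Phi> A B h, \<phi>o B)" "\<Phi> A B h \<in> lie_homs (\<phi>o A) (\<phi>o B)"
    by (simp_all add: \<Phi>_def Mor_iff)
qed

lemma \<Phi>_id: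
  assumes "A \<in> obs"
  shows "\<Phi> A A (\<lambda>x\<in>lcarrier A. x) = (\<lambda>x\<in>lcarrier (\<phi>o A). x)"
proof -
  have "\<phi>m (A, \<lambda>x\<in>lcarrier A. x, A) = (\<phi>o A, \<lambda>x\<in>lcarrier (\<phi>o A). x, \<phi>o A)"
    using \<phi>m_Ident[OF assms] by (simp add: cat_simps)
  then show ?thesis by (simp add: \<Phi>_def)
qed

lemma \<Phi>_comp:
  assumes "A \<in> obs" "B \<in> obs" "C \<in> obs" and f: "f \<in> lie_homs A B" and g: "g \<in> lie_homs B C"
  shows "\<Phi> A C (compose (lcarrier A) g f) = compose (lcarrier (\<phi>o A)) (\<Phi> B C g) (\<Phi> A B f)"
proof -
  have "(A, f, B) \<in> Mor \<C>" "(B, g, C) \<in> Mor \<C>" using assms by (simp_all add: Mor_iff)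
  from \<phi>m_Comp[OF this] have "\<phi>m (A, compose (lcarrier A) g f, C) =
      (\<phi>o A, compose (lcarrier (\<phi>o A)) (\<Phi> B C g) (\<Phi> A B f), \<phi>o C)"
    using assms by (simp add: \<phi>m_eq cat_simps)
  then show ?thesis by (simp add: \<Phi>_def)
qed

lemma
  shows obj_surj: "B \<in> obs \<Longrightarrow> \<exists>A\<in>obs. \<phi>o A = B"
    and \<Phi>_inj: "\<lbrakk>A \<in> obs; B \<in> obs; h \<in> lie_homs A B; k \<in> lie_homs A B; \<Phi> A B h = \<Phi> A B k\<rbrakk> \<Longrightarrow> h = k"
    and \<Phi>_surj: "\<lbrakk>A \<in> obs; B \<in> obs; k \<in> lie_homs (\<phi>o A) (\<phi>o B)\<rbrakk> \<Longrightarrow> \<exists>h\<in>lie_homs A B. \<Phi> A B h = k"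
proof -
  obtain \<psi>o \<psi>m where \<psi>: "is_functor \<C> \<C> \<psi>o \<psi>m"
    and o: "\<forall>A\<in>obs. \<psi>o (\<phi>o A) = A \<and> \<phi>o (\<psi>o A) = A"
    and m: "\<forall>f\<in>Mor \<C>. \<psi>m (\<phi>m f) = f \<and> \<phi>m (\<psi>m f) = f"
    using automorphism[unfolded category_automorphism_def cat_simps(1)] by blast
  have \<psi>_ob: "\<psi>o A \<in> obs" if "A \<in> obs" for A
    using \<psi>[unfolded is_functor_def cat_simps(1)] that by blast
  show "B \<in> obs \<Longrightarrow> \<exists>A\<in>obs. \<phi>o A = B" using o \<psi>_ob by blast
  show "h = k" if "A \<in> obs" "B \<in> obs" "h \<in> lie_homs A B" "k \<in> lie_homs A B" "\<Phi> A B h = \<Phi> A B k"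
  proof -
    have "\<phi>m (A, h, B) = \<phi>m (A, k, B)" using that by (simp add: \<phi>m_eq)
    moreover have "(A, h, B) \<in> Mor \<C>" "(A, k, B) \<in> Mor \<C>" using that by (simp_all add: Mor_iff)
    ultimately have "(A, h, B) = (A, k, B)" using m by metis
    then show ?thesis by simp
  qed
  show "\<exists>h\<in>lie_homs A B. \<Phi> A B h = k" if A: "A \<in> obs" and B: "B \<in> obs"
    and k: "k \<in> lie_homs (\<phi>o A) (\<phi>o B)"
  proof -
    have M: "(\<phi>o A, k, \<phi>o B) \<in> Mor \<C>" using A B k by (simp add: Mor_iff obj)
    then have "\<psi>m (\<phi>o A, k, \<phi>o B) \<in> Mor \<C>"
      using \<psi>[unfolded is_functor_def] by blast
    moreover obtain A' h B' where h: "\<psi>m (\<phi>o A, k, \<phi>o B) = (A', h, B')"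
      by (cases "\<psi>m (\<phi>o A, k, \<phi>o B)")
    ultimately have "A' \<in> obs" "B' \<in> obs" "h \<in> lie_homs A' B'" by (simp_all add: Mor_iff)
    moreover have "\<phi>m (A', h, B') = (\<phi>o A, k, \<phi>o B)" using bspec[OF m M] h by simp
    ultimately have "\<phi>o A' = \<phi>o A" "\<phi>o B' = \<phi>o B" "\<Phi> A' B' h = k"
      by (simp_all add: \<phi>m_eq)
    moreover have "A' = A" "B' = B" using calculation o \<open>A' \<in> obs\<close> \<open>B' \<in> obs\<close> A B by metis+
    ultimately show ?thesis using \<open>h \<in> lie_homs A' B'\<close> by auto
  qed
qed

lemma ob_free_lie: "finite X \<Longrightarrow> X \<subseteq> V \<Longrightarrow> free_lie X \<in> obs"
  by (auto simp: free_lie_objects_def)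

lemma ob_lie_algebra: "A \<in> obs \<Longrightarrow> lie_algebra A"
  by (rule lie_algebra_free_lie_objects)

lemma homsD: "h \<in> lie_homs A B \<Longrightarrow> lie_hom A B h"
  by (simp add: lie_homs_def)

lemma compose_in: "A \<in> obs \<Longrightarrow> f \<in> lie_homs A B \<Longrightarrow> g \<in> lie_homs B C \<Longrightarrow>
    compose (lcarrier A) g f \<in> lie_homs A C"
  by (auto simp: lie_homs_def intro: lie_hom_compose ob_lie_algebra)

lemma homs_ext: "f \<in> lie_homs A B \<Longrightarrow> g \<in> lie_homs A C \<Longrightarrow> (\<And>a. a \<in> lcarrier A \<Longrightarrow> f a = g a) \<Longrightarrow> f = g"
  by (auto simp: lie_homs_def intro: extensionalityI)

lemma homs_free_eqI:
  assumes "B \<in> obs" "f \<in> lie_homs (free_lie X) B" "g \<in> lie_homs (free_lie X) B"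
    and "\<And>x. x \<in> X \<Longrightarrow> f (gen X x) = g (gen X x)"
  shows "f = g"
  by (rule homs_ext[OF assms(2,3)],
      rule free_lie_hom_eqI[OF ob_lie_algebra[OF assms(1)] assms(2,3)[THEN homsD] assms(4)])

text \<open>Among the objects, the free algebras on one generator are those whose endomorphism monoid is
  commutative and has more than one element; hence they are permuted by the automorphism.\<close>

lemma ex_generator:
  assumes "x0 \<in> V"
  shows "\<exists>y0. y0 \<in> V \<and> \<phi>o (free_lie {x0}) = free_lie {y0}"
proof -
  let ?F = "free_lie {x0} :: ('p, 'v) free_lie_struct"
  have F: "?F \<in> obs" using assms by (simp add: ob_free_lie)
  interpret F: lie_algebra ?F by (rule lie_algebra_free_lie)
  obtain Y where Y: "finite Y" "Y \<subseteq> V" "\<phi>o ?F = free_lie Y"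
    using obj[OF F] by (auto simp: free_lie_objects_def)
  have FY: "free_lie Y \<in> obs" using Y by (simp add: ob_free_lie)
  have comm: "f (g a) = g (f a)" if fg: "f \<in> lie_homs (free_lie Y) (free_lie Y)"
    "g \<in> lie_homs (free_lie Y) (free_lie Y)" and a: "a \<in> lcarrier (free_lie Y)"
    for f g :: "('p, 'v) lterm set \<Rightarrow> ('p, 'v) lterm set" and a
  proof -
    obtain f' g' where f': "f' \<in> lie_homs ?F ?F" "f = \<Phi> ?F ?F f'"
      and g': "g' \<in> lie_homs ?F ?F" "g = \<Phi> ?F ?F g'"
      using \<Phi>_surj[OF F F] fg Y(3) by metis
    have "compose (lcarrier ?F) f' g' = compose (lcarrier ?F) g' f'"
    proof (rule homs_free_eqI[OF F compose_in[OF F g'(1) f'(1)] compose_in[OF F f'(1) g'(1)]])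
      fix x assume "x \<in> {x0}"
      obtain l where l: "f' (gen {x0} x0) = lscale ?F l (gen {x0} x0)"
        using free_lie_singleton[OF lie_hom_closed[OF homsD[OF f'(1)]], of "gen {x0} x0"] by auto
      obtain m where m: "g' (gen {x0} x0) = lscale ?F m (gen {x0} x0)"
        using free_lie_singleton[OF lie_hom_closed[OF homsD[OF g'(1)]], of "gen {x0} x0"] by auto
      show "compose (lcarrier ?F) f' g' (gen {x0} x) = compose (lcarrier ?F) g' f' (gen {x0} x)"
        using \<open>x \<in> {x0}\<close> l m
        by (simp add: compose_def lie_hom_scale[OF homsD[OF f'(1)]] lie_hom_scale[OF homsD[OF g'(1)]]
            mult.commute flip: F.scale_scale)
    qed
    then have "compose (lcarrier (free_lie Y)) f g = compose (lcarrier (free_lie Y)) g f"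
      using \<Phi>_comp[OF F F F g'(1) f'(1)] \<Phi>_comp[OF F F F f'(1) g'(1)] f'(2) g'(2) Y(3) by metis
    then show ?thesis using a by (metis compose_eq)
  qed
  have one: "x = y" if xy: "x \<in> Y" "y \<in> Y" for x y
  proof (rule ccontr)
    assume "x \<noteq> y"
    \<comment> \<open>the endomorphisms that collapse all generators to \<open>x\<close>, respectively \<open>y\<close>, do not commute\<close>
    let ?f = "free_lift Y (free_lie Y) (\<lambda>_. gen Y x) :: ('p, 'v) lterm set \<Rightarrow> ('p, 'v) lterm set"
    let ?g = "free_lift Y (free_lie Y) (\<lambda>_. gen Y y) :: ('p, 'v) lterm set \<Rightarrow> ('p, 'v) lterm set"
    have "?f (?g (gen Y x)) = ?g (?f (gen Y x))"
      by (rule comm; (rule free_lift_in_homs[OF lie_algebra_free_lie])?) (use xy in simp_all)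
    then have "(gen Y x :: ('p, 'v) lterm set) = gen Y y"
      using xy by (simp add: free_lift_Var[OF lie_algebra_free_lie])
    with gen_neq[OF xy \<open>x \<noteq> y\<close>] show False by blast
  qed
  have "Y \<noteq> {}"
  proof
    assume "Y = {}"
    \<comment> \<open>zero and the identity are distinct endomorphisms of \<open>F({x0})\<close>, but \<open>F({})\<close> has only one\<close>
    define z where "z = free_lift {x0} ?F (\<lambda>_. lzero ?F)"
    define i where "i = (\<lambda>x\<in>lcarrier ?F. x)"
    have z: "z \<in> lie_homs ?F ?F"
      unfolding z_def by (rule free_lift_in_homs[OF lie_algebra_free_lie]) (rule F.zero_closed)
    have i: "i \<in> lie_homs ?F ?F"
      by (simp add: i_def lie_homs_def lie_hom_id[OF lie_algebra_free_lie])
    have "\<Phi> ?F ?F z = \<Phi> ?F ?F i"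
    proof (rule homs_free_eqI[of _ _ Y])
      show "\<Phi> ?F ?F z \<in> lie_homs (free_lie Y) (free_lie Y)" "\<Phi> ?F ?F i \<in> lie_homs (free_lie Y) (free_lie Y)"
        using \<Phi>_in[OF F F z] \<Phi>_in[OF F F i] Y(3) by simp_all
    qed (use FY \<open>Y = {}\<close> in auto)
    then have "z = i" using \<Phi>_inj[OF F F z i] by blast
    then have "z (gen {x0} x0) = gen {x0} x0" by (simp add: i_def)
    moreover have "z (gen {x0} x0) = lzero ?F"
      unfolding z_def by (rule free_lift_Var[OF lie_algebra_free_lie F.zero_closed]) simp
    moreover have "gen {x0} x0 \<noteq> lzero ?F" by (rule gen_neq_zero) simp
    ultimately show False by simp
  qed
  then obtain y0 where "Y = {y0}" using one by blast
  then show ?thesis using Y by auto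
qed

end


section \<open>The induced bijections\<close>

text \<open>The variable \<open>y0\<close> is the generator of the image of \<open>F({x0})\<close>; the two distinct variables \<open>x1\<close>
  and \<open>x2\<close>, of which one may be \<open>x0\<close>, serve as the arguments of binary operations.\<close>

locale based_automorphism = free_lie_automorphism V \<phi>o \<phi>m
  for V :: "'v set"
    and \<phi>o :: "('p::field, 'v) free_lie_struct \<Rightarrow> ('p, 'v) free_lie_struct"
    and \<phi>m :: "('p, 'v) free_lie_mor \<Rightarrow> ('p, 'v) free_lie_mor" +
  fixes x0 y0 x1 x2 :: 'v
  assumes x0: "x0 \<in> V" and y0: "y0 \<in> V"
    and \<phi>o_x0: "\<phi>o (free_lie {x0}) = free_lie {y0}"
    and x1: "x1 \<in> V" and x2: "x2 \<in> V" and x12: "x1 \<noteq> x2"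
begin

abbreviation F0 :: "('p, 'v) free_lie_struct" where "F0 \<equiv> free_lie {x0}"
abbreviation E0 :: "('p, 'v) free_lie_struct" where "E0 \<equiv> free_lie {y0}"

lemma F0: "F0 \<in> obs" and E0: "E0 \<in> obs"
  using x0 y0 by (simp_all add: ob_free_lie)

text \<open>The homomorphism from the free algebra on one generator that points to the element \<open>a\<close>.\<close>

definition pt :: "('p, 'v) free_lie_struct \<Rightarrow> ('p, 'v) lterm set \<Rightarrow> ('p, 'v) lterm set \<Rightarrow> ('p, 'v) lterm set" where
  "pt A a = free_lift {x0} A (\<lambda>_. a)"

lemma
  assumes "A \<in> obs" "a \<in> lcarrier A"
  shows pt_in: "pt A a \<in> lie_homs F0 A" and pt_gen: "pt A a (gen {x0} x0) = a"
proof -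
  note L = ob_lie_algebra[OF assms(1)]
  show "pt A a \<in> lie_homs F0 A" unfolding pt_def by (rule free_lift_in_homs[OF L assms(2)])
  show "pt A a (gen {x0} x0) = a"
    unfolding pt_def by (rule free_lift_Var[OF L assms(2)]) simp
qed

lemma pt_eqI:
  assumes "A \<in> obs" "h \<in> lie_homs F0 A" "h (gen {x0} x0) = a"
  shows "h = pt A a"
proof -
  have a: "a \<in> lcarrier A" using lie_hom_closed[OF homsD[OF assms(2)], of "gen {x0} x0"] assms(3) by simp
  show ?thesis
    using assms pt_gen[OF assms(1) a] by (intro homs_free_eqI[OF assms(1,2) pt_in[OF assms(1) a]]) auto
qed

text \<open>The bijection from \<open>A\<close> to its image obtained by identifying elements with homomorphisms from the
  free algebra on one generator.\<close>

definition s :: "('p, 'v) free_lie_struct \<Rightarrow> ('p, 'v) lterm set \<Rightarrow> ('p, 'v) lterm set" where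
  "s A a = \<Phi> F0 A (pt A a) (gen {y0} y0)"

lemma \<Phi>_F0_in: "A \<in> obs \<Longrightarrow> h \<in> lie_homs F0 A \<Longrightarrow> \<Phi> F0 A h \<in> lie_homs E0 (\<phi>o A)"
  using \<Phi>_in[OF F0, of A h] \<phi>o_x0 by simp

lemma s_closed: "A \<in> obs \<Longrightarrow> a \<in> lcarrier A \<Longrightarrow> s A a \<in> lcarrier (\<phi>o A)"
  unfolding s_def by (rule lie_hom_closed[OF homsD[OF \<Phi>_F0_in[OF _ pt_in]]]) simp_all

lemma s_natural:
  assumes A: "A \<in> obs" and B: "B \<in> obs" and h: "h \<in> lie_homs A B" and a: "a \<in> lcarrier A"
  shows "\<Phi> A B h (s A a) = s B (h a)"
proof -
  have "compose (lcarrier F0) h (pt A a) = pt B (h a)"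
    by (rule pt_eqI[OF B compose_in[OF F0 pt_in[OF A a] h]]) (simp add: compose_def pt_gen[OF A a])
  then have "s B (h a) = compose (lcarrier E0) (\<Phi> A B h) (\<Phi> F0 A (pt A a)) (gen {y0} y0)"
    using \<Phi>_comp[OF F0 A B pt_in[OF A a] h] \<phi>o_x0 by (simp add: s_def)
  then show ?thesis by (simp add: compose_def s_def)
qed

lemma bij_s:
  assumes A: "A \<in> obs"
  shows "bij_betw (s A) (lcarrier A) (lcarrier (\<phi>o A))"
proof (rule bij_betw_imageI)
  show "inj_on (s A) (lcarrier A)"
  proof (rule inj_onI)
    fix a b assume a: "a \<in> lcarrier A" and b: "b \<in> lcarrier A" and eq: "s A a = s A b"
    note H = \<Phi>_F0_in[OF A pt_in[OF A a]] \<Phi>_F0_in[OF A pt_in[OF A b]]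
    have "\<Phi> F0 A (pt A a) = \<Phi> F0 A (pt A b)"
    proof (rule homs_free_eqI[OF obj[OF A] H])
      fix x assume "x \<in> {y0}"
      then have "x = y0" by blast
      with eq show "\<Phi> F0 A (pt A a) (gen {y0} x) = \<Phi> F0 A (pt A b) (gen {y0} x)"
        unfolding s_def by blast
    qed
    then have "pt A a = pt A b" by (rule \<Phi>_inj[OF F0 A pt_in[OF A a] pt_in[OF A b]])
    then show "a = b" using pt_gen[OF A a] pt_gen[OF A b] by metis
  qed
  have "b \<in> s A ` lcarrier A" if b: "b \<in> lcarrier (\<phi>o A)" for b
  proof -
    define k where "k = free_lift {y0} (\<phi>o A) (\<lambda>_. b)"
    note L = ob_lie_algebra[OF obj[OF A]]
    have k: "k \<in> lie_homs (\<phi>o F0) (\<phi>o A)" "k (gen {y0} y0) = b"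
      unfolding k_def \<phi>o_x0
      by (rule free_lift_in_homs[OF L b]) (rule free_lift_Var[OF L b], simp)
    obtain h where h: "h \<in> lie_homs F0 A" "\<Phi> F0 A h = k" using \<Phi>_surj[OF F0 A k(1)] by blast
    have "s A (h (gen {x0} x0)) = b"
      by (simp add: s_def h(2) k(2) flip: pt_eqI[OF A h(1) HOL.refl])
    moreover have "h (gen {x0} x0) \<in> lcarrier A" using lie_hom_closed[OF homsD[OF h(1)]] by simp
    ultimately show ?thesis by blast
  qed
  then show "s A ` lcarrier A = lcarrier (\<phi>o A)"
    by (intro equalityI image_subsetI s_closed[OF A] subsetI)
qed

text \<open>The bijection of the field induced on the multiples of the generator; \<open>s_F0\<close> shows that the
  defining choice exists, and \<open>y0_scale_eq\<close> that it is unique.\<close>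

definition \<sigma> :: "'p \<Rightarrow> 'p" where
  "\<sigma> l = (SOME m. s F0 (lscale F0 l (gen {x0} x0)) = lscale E0 m (gen {y0} y0))"

lemma s_F0: "s F0 (lscale F0 l (gen {x0} x0)) = lscale E0 (\<sigma> l) (gen {y0} y0)"
proof -
  have "s F0 (lscale F0 l (gen {x0} x0)) \<in> lcarrier E0"
    using s_closed[OF F0] lie_algebra.scale_closed[OF lie_algebra_free_lie] \<phi>o_x0 by (metis lie_class_closed
      lterms_simps(1) singletonI)
  then obtain m where "s F0 (lscale F0 l (gen {x0} x0)) = lscale E0 m (gen {y0} y0)"
    by (rule free_lie_singleton)
  then show ?thesis unfolding \<sigma>_def by (rule someI)
qed

lemma s_scale:
  assumes A: "A \<in> obs" and a: "a \<in> lcarrier A"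
  shows "s A (lscale A l a) = lscale (\<phi>o A) (\<sigma> l) (s A a)"
proof -
  interpret F0: lie_algebra F0 by (rule lie_algebra_free_lie)
  have "lscale A l a = pt A a (lscale F0 l (gen {x0} x0))"
    by (simp add: lie_hom_scale[OF homsD[OF pt_in[OF A a]]] pt_gen[OF A a])
  then have "s A (lscale A l a) = \<Phi> F0 A (pt A a) (s F0 (lscale F0 l (gen {x0} x0)))"
    by (simp add: s_natural[OF F0 A pt_in[OF A a]] F0.scale_closed)
  also have "\<dots> = lscale (\<phi>o A) (\<sigma> l) (s A a)"
    unfolding s_F0 by (simp add: lie_hom_scale[OF homsD[OF \<Phi>_F0_in[OF A pt_in[OF A a]]]] s_def)
  finally show ?thesis .
qed

lemma s_gen0: "s F0 (gen {x0} x0) = gen {y0} y0"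
proof -
  have i: "(\<lambda>x\<in>lcarrier F0. x) \<in> lie_homs F0 F0"
    by (simp add: lie_homs_def lie_hom_id[OF lie_algebra_free_lie])
  have "(\<lambda>x\<in>lcarrier F0. x) = pt F0 (gen {x0} x0)" by (rule pt_eqI[OF F0 i]) simp
  then show ?thesis using \<Phi>_id[OF F0] \<phi>o_x0 by (simp add: s_def flip: \<open>_ = pt F0 _\<close>)
qed

lemma y0_scale_eq:
  assumes "lscale E0 a (gen {y0} y0) = lscale E0 b (gen {y0} y0)"
  shows "a = b"
proof -
  have "gen {y0} y0 \<in> lcarrier E0" by simp
  moreover have "gen {y0} y0 \<noteq> lzero E0" by (rule gen_neq_zero) (rule singletonI)
  ultimately show ?thesis using lie_algebra.scale_eq_scale[OF lie_algebra_free_lie _ assms] by blast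
qed

lemma \<sigma>_1: "\<sigma> 1 = 1"
proof (rule y0_scale_eq)
  show "lscale E0 (\<sigma> 1) (gen {y0} y0) = lscale E0 1 (gen {y0} y0)"
    using s_F0[of 1] by (simp add: s_gen0 lie_algebra.scale_one[OF lie_algebra_free_lie])
qed

lemma \<sigma>_mult: "\<sigma> (a * b) = \<sigma> a * \<sigma> b"
proof (rule y0_scale_eq)
  interpret F0: lie_algebra F0 by (rule lie_algebra_free_lie)
  interpret E0: lie_algebra E0 by (rule lie_algebra_free_lie)
  have "s F0 (lscale F0 (a * b) (gen {x0} x0)) = s F0 (lscale F0 a (lscale F0 b (gen {x0} x0)))"
    by (simp add: F0.scale_scale)
  also have "\<dots> = lscale E0 (\<sigma> a) (lscale E0 (\<sigma> b) (gen {y0} y0))"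
    using s_scale[OF F0 F0.scale_closed, of "gen {x0} x0"] \<phi>o_x0 by (simp add: s_F0)
  finally show "lscale E0 (\<sigma> (a * b)) (gen {y0} y0) = lscale E0 (\<sigma> a * \<sigma> b) (gen {y0} y0)"
    by (simp add: s_F0 E0.scale_scale)
qed

lemma bij_\<sigma>: "bij \<sigma>"
proof (rule bijI)
  interpret F0: lie_algebra F0 by (rule lie_algebra_free_lie)
  interpret E0: lie_algebra E0 by (rule lie_algebra_free_lie)
  have g: "gen {x0} x0 \<in> lcarrier F0" "gen {y0} y0 \<in> lcarrier E0" by simp_all
  have bij: "bij_betw (s F0) (lcarrier F0) (lcarrier E0)" using bij_s[OF F0] \<phi>o_x0 by simp
  show "inj \<sigma>"
  proof (rule injI)
    fix a b assume "\<sigma> a = \<sigma> b"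
    then have "s F0 (lscale F0 a (gen {x0} x0)) = s F0 (lscale F0 b (gen {x0} x0))" by (simp add: s_F0)
    then have "lscale F0 a (gen {x0} x0) = lscale F0 b (gen {x0} x0)"
      by (rule inj_onD[OF bij_betw_imp_inj_on[OF bij]]) (simp_all add: F0.scale_closed)
    then show "a = b" by (rule F0.scale_eq_scale[OF g(1) _ gen_neq_zero]) simp
  qed
  show "surj \<sigma>"
    unfolding surj_def
  proof
    fix m
    have "lscale E0 m (gen {y0} y0) \<in> s F0 ` lcarrier F0"
      using bij g(2) by (simp add: bij_betw_def E0.scale_closed)
    then obtain a where a: "a \<in> lcarrier F0" "s F0 a = lscale E0 m (gen {y0} y0)" by auto
    obtain l where "a = lscale F0 l (gen {x0} x0)" using free_lie_singleton[OF a(1)] .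
    then have "m = \<sigma> l" using a(2) by (intro y0_scale_eq) (simp add: s_F0)
    then show "\<exists>l. m = \<sigma> l" ..
  qed
qed

lemma \<sigma>_0: "\<sigma> 0 = 0"
proof -
  obtain l where "\<sigma> l = 0" using bij_\<sigma> by (metis bij_pointE)
  then show ?thesis using \<sigma>_mult[of 0 l] by simp
qed

lemma \<sigma>_power: "\<sigma> (a ^ n) = \<sigma> a ^ n"
  by (induction n) (simp_all add: \<sigma>_1 \<sigma>_mult)

lemma s_zero: "A \<in> obs \<Longrightarrow> s A (lzero A) = lzero (\<phi>o A)"
  using s_scale[of A "lzero A" 0] ob_lie_algebra[of A] ob_lie_algebra[OF obj, of A]
  by (simp add: \<sigma>_0 lie_algebra.scale_zero lie_algebra.zero_closed s_closed)


section \<open>Transport of the operations\<close>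

abbreviation G :: "('p, 'v) free_lie_struct" where "G \<equiv> free_lie {x1, x2}"
abbreviation e1 :: "('p, 'v) lterm set" where "e1 \<equiv> gen {x1, x2} x1"
abbreviation e2 :: "('p, 'v) lterm set" where "e2 \<equiv> gen {x1, x2} x2"

lemma G: "G \<in> obs"
  using x1 x2 by (simp add: ob_free_lie)

lemma e_closed: "e1 \<in> lcarrier G" "e2 \<in> lcarrier G"
  by simp_all

text \<open>An element \<open>w\<close> of \<open>G\<close> is regarded as a binary operation on every object; \<open>ev A a b w\<close> is its value
  at \<open>a\<close> and \<open>b\<close> in \<open>A\<close>.\<close>

definition ev :: "('p, 'v) free_lie_struct \<Rightarrow> ('p, 'v) lterm set \<Rightarrow> ('p, 'v) lterm set \<Rightarrow>
    ('p, 'v) lterm set \<Rightarrow> ('p, 'v) lterm set" where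
  "ev A a b = free_lift {x1, x2} A (\<lambda>x. if x = x1 then a else b)"

lemma
  assumes "A \<in> obs" "a \<in> lcarrier A" "b \<in> lcarrier A"
  shows ev_in: "ev A a b \<in> lie_homs G A" and ev_e1: "ev A a b e1 = a" and ev_e2: "ev A a b e2 = b"
proof -
  have f: "(if x = x1 then a else b) \<in> lcarrier A" if "x \<in> {x1, x2}" for x using assms by simp
  show "ev A a b \<in> lie_homs G A"
    unfolding ev_def by (rule free_lift_in_homs[OF ob_lie_algebra[OF assms(1)] f])
  show "ev A a b e1 = a"
    unfolding ev_def by (subst free_lift_Var[OF ob_lie_algebra[OF assms(1)] f]) auto
  show "ev A a b e2 = b"
    unfolding ev_def by (subst free_lift_Var[OF ob_lie_algebra[OF assms(1)] f]) (use x12 in auto)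
qed

lemma ev_eqI:
  assumes "A \<in> obs" "h \<in> lie_homs G A" "h e1 = a" "h e2 = b"
  shows "h = ev A a b"
proof -
  have ab: "a \<in> lcarrier A" "b \<in> lcarrier A"
    using lie_hom_closed[OF homsD[OF assms(2)], OF e_closed(1)]
      lie_hom_closed[OF homsD[OF assms(2)], OF e_closed(2)] assms(3,4) by simp_all
  show ?thesis
    using assms ev_e1[OF assms(1) ab] ev_e2[OF assms(1) ab]
    by (intro homs_free_eqI[OF assms(1,2) ev_in[OF assms(1) ab]]) auto
qed

text \<open>The elements \<open>s G e1\<close> and \<open>s G e2\<close> generate the image \<open>Q\<close> of \<open>G\<close>. Writing \<open>G\<close> as the image of
  an object \<open>H\<close>, naturality provides a homomorphism \<open>\<eta>\<close> from \<open>Q\<close> to \<open>G\<close> that maps them to \<open>e1\<close> and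
  \<open>e2\<close>. Its composite with the homomorphism back fixes both elements; as the image of an endomorphism
  of \<open>G\<close> that fixes \<open>e1\<close> and \<open>e2\<close>, it is the identity.\<close>

lemma ev_s_surj:
  assumes w: "w \<in> lcarrier (\<phi>o G)"
  shows "\<exists>W\<in>lcarrier G. w = ev (\<phi>o G) (s G e1) (s G e2) W"
proof -
  let ?f1 = "s G e1" and ?f2 = "s G e2" and ?Q = "\<phi>o G"
  have Q: "?Q \<in> obs" using obj[OF G] .
  have f: "?f1 \<in> lcarrier ?Q" "?f2 \<in> lcarrier ?Q" by (simp_all add: s_closed[OF G])
  obtain H where H: "H \<in> obs" "\<phi>o H = G" using obj_surj[OF G] by blast
  have img: "s H ` lcarrier H = lcarrier G" using bij_s[OF H(1)] H(2) by (simp add: bij_betw_def)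
  obtain a1 where a1: "a1 \<in> lcarrier H" "s H a1 = e1" using img e_closed(1) by (metis imageE)
  obtain a2 where a2: "a2 \<in> lcarrier H" "s H a2 = e2" using img e_closed(2) by (metis imageE)
  define h where "h = ev H a1 a2"
  have h: "h \<in> lie_homs G H" "h e1 = a1" "h e2 = a2"
    unfolding h_def
    by (rule ev_in[OF H(1) a1(1) a2(1)] ev_e1[OF H(1) a1(1) a2(1)] ev_e2[OF H(1) a1(1) a2(1)])+
  define \<eta> where "\<eta> = \<Phi> G H h"
  have \<eta>: "\<eta> \<in> lie_homs ?Q G" "\<eta> ?f1 = e1" "\<eta> ?f2 = e2"
    using \<Phi>_in[OF G H(1) h(1)] s_natural[OF G H(1) h(1) e_closed(1)]
      s_natural[OF G H(1) h(1) e_closed(2)]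
    by (simp_all only: \<eta>_def H(2) h a1 a2)
  define k where "k = compose (lcarrier ?Q) (ev ?Q ?f1 ?f2) \<eta>"
  have k: "k \<in> lie_homs ?Q ?Q"
    unfolding k_def by (rule compose_in[OF Q \<eta>(1) ev_in[OF Q f]])
  have kf: "k ?f1 = ?f1" "k ?f2 = ?f2"
    using f \<eta> ev_e1[OF Q f] ev_e2[OF Q f] by (simp_all add: k_def compose_def)
  obtain g where g: "g \<in> lie_homs G G" "\<Phi> G G g = k" using \<Phi>_surj[OF G G k] by blast
  have inj: "inj_on (s G) (lcarrier G)" using bij_s[OF G] by (simp add: bij_betw_def)
  have ge: "g e1 \<in> lcarrier G" "g e2 \<in> lcarrier G" using lie_hom_closed[OF homsD[OF g(1)]] by simp_all
  have "s G (g e1) = s G e1" "s G (g e2) = s G e2"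
    using s_natural[OF G G g(1)] g(2) kf by (metis e_closed)+
  then have "g e1 = e1" "g e2 = e2" using inj_onD[OF inj] ge e_closed by metis+
  moreover have i: "(\<lambda>x\<in>lcarrier G. x) \<in> lie_homs G G"
    by (simp add: lie_homs_def lie_hom_id[OF lie_algebra_free_lie])
  ultimately have "g = (\<lambda>x\<in>lcarrier G. x)" by (intro homs_free_eqI[OF G g(1) i]) auto
  then have "k = (\<lambda>x\<in>lcarrier ?Q. x)" using g(2) \<Phi>_id[OF G] by simp
  then have "k w = w" using w by simp
  then have "w = ev ?Q ?f1 ?f2 (\<eta> w)" using w by (simp add: k_def compose_eq)
  moreover have "\<eta> w \<in> lcarrier G" by (rule lie_hom_closed[OF homsD[OF \<eta>(1)] w])
  ultimately show ?thesis by blast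
qed

text \<open>Hence \<open>s\<close> carries every binary operation given by an element of \<open>G\<close> to such an operation.\<close>

lemma ex_transported_operation:
  assumes w: "w \<in> lcarrier G"
  obtains W where "W \<in> lcarrier G"
    and "\<And>A a b. \<lbrakk>A \<in> obs; a \<in> lcarrier A; b \<in> lcarrier A\<rbrakk> \<Longrightarrow>
      s A (ev A a b w) = ev (\<phi>o A) (s A a) (s A b) W"
proof -
  let ?\<theta> = "ev (\<phi>o G) (s G e1) (s G e2)"
  have Q: "\<phi>o G \<in> obs" using obj[OF G] .
  have f: "s G e1 \<in> lcarrier (\<phi>o G)" "s G e2 \<in> lcarrier (\<phi>o G)" by (simp_all add: s_closed[OF G])
  obtain W where W: "W \<in> lcarrier G" "s G w = ?\<theta> W" using ev_s_surj[OF s_closed[OF G w]] by blast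
  have "s A (ev A a b w) = ev (\<phi>o A) (s A a) (s A b) W"
    if A: "A \<in> obs" and a: "a \<in> lcarrier A" and b: "b \<in> lcarrier A" for A a b
  proof -
    let ?h = "ev A a b"
    have h: "?h \<in> lie_homs G A" using ev_in[OF A a b] .
    have \<Phi>h: "\<Phi> G A ?h \<in> lie_homs (\<phi>o G) (\<phi>o A)" using \<Phi>_in[OF G A h] .
    have "compose (lcarrier G) (\<Phi> G A ?h) ?\<theta> = ev (\<phi>o A) (s A a) (s A b)"
      by (rule ev_eqI[OF obj[OF A] compose_in[OF G ev_in[OF Q f] \<Phi>h]])
        (simp_all add: compose_def ev_e1[OF Q f] ev_e2[OF Q f] s_natural[OF G A h]
          ev_e1[OF A a b] ev_e2[OF A a b])
    from this[symmetric] have "ev (\<phi>o A) (s A a) (s A b) W = \<Phi> G A ?h (?\<theta> W)"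
      using W(1) by (simp add: compose_eq)
    also have "\<dots> = s A (?h w)" using s_natural[OF G A h w] W(2) by simp
    finally show ?thesis by simp
  qed
  with W(1) show thesis by (rule that)
qed

text \<open>If the operation is homogeneous of degree \<open>k\<close> as a function, then the transported one is so too,
  because \<open>\<sigma>\<close> is multiplicative and onto. Evaluation at the generators of \<open>G\<close>, which are values of
  \<open>s H\<close> for an object \<open>H\<close> with image \<open>G\<close>, turns this into homogeneity of the element \<open>W\<close>.\<close>

lemma transported_homog:
  assumes w: "w \<in> lcarrier G" and W: "W \<in> lcarrier G"
    and trans: "\<And>A a b. \<lbrakk>A \<in> obs; a \<in> lcarrier A; b \<in> lcarrier A\<rbrakk> \<Longrightarrow>
      s A (ev A a b w) = ev (\<phi>o A) (s A a) (s A b) W"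
    and deg: "\<And>A a b l. \<lbrakk>A \<in> obs; a \<in> lcarrier A; b \<in> lcarrier A\<rbrakk> \<Longrightarrow>
      ev A (lscale A l a) (lscale A l b) w = lscale A (l ^ k) (ev A a b w)"
  shows "homog G {e1, e2} k W"
proof -
  interpret G: lie_algebra G by (rule lie_algebra_free_lie)
  have B: "{e1, e2} \<subseteq> lcarrier G" by simp
  obtain H where H: "H \<in> obs" "\<phi>o H = G" using obj_surj[OF G] by blast
  interpret H: lie_algebra H by (rule ob_lie_algebra[OF H(1)])
  have img: "s H ` lcarrier H = lcarrier G" using bij_s[OF H(1)] H(2) by (simp add: bij_betw_def)
  obtain a1 where a1: "a1 \<in> lcarrier H" "s H a1 = e1" using img e_closed(1) by (metis imageE)
  obtain a2 where a2: "a2 \<in> lcarrier H" "s H a2 = e2" using img e_closed(2) by (metis imageE)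
  have i: "(\<lambda>x\<in>lcarrier G. x) \<in> lie_homs G G"
    by (simp add: lie_homs_def lie_hom_id[OF lie_algebra_free_lie])
  have W1: "W = s H (ev H a1 a2 w)"
  proof -
    have "(\<lambda>x\<in>lcarrier G. x) = ev G e1 e2" by (rule ev_eqI[OF G i]) simp_all
    then have "ev G e1 e2 W = W" using W by (metis restrict_apply')
    then show ?thesis using trans[OF H(1) a1(1) a2(1)] a1(2) a2(2) H(2) by simp
  qed
  have eig: "ev G (lscale G m e1) (lscale G m e2) W = lscale G (m ^ k) W" for m
  proof -
    obtain l where l: "m = \<sigma> l" using bij_\<sigma> by (metis bij_pointE)
    have sc: "lscale H l a1 \<in> lcarrier H" "lscale H l a2 \<in> lcarrier H"
      using a1 a2 by (simp_all add: H.scale_closed)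
    have evcl: "ev H a1 a2 w \<in> lcarrier H"
      by (rule lie_hom_closed[OF homsD[OF ev_in[OF H(1) a1(1) a2(1)]] w])
    have "ev G (lscale G m e1) (lscale G m e2) W = s H (ev H (lscale H l a1) (lscale H l a2) w)"
      using trans[OF H(1) sc] s_scale[OF H(1) a1(1), of l] s_scale[OF H(1) a2(1), of l] a1(2) a2(2) H(2) l
      by simp
    also have "\<dots> = lscale G (\<sigma> (l ^ k)) W"
      using deg[OF H(1) a1(1) a2(1)] s_scale[OF H(1) evcl] H(2) W1 by simp
    finally show ?thesis by (simp add: l \<sigma>_power)
  qed
  obtain t where t: "t \<in> lterms {x1, x2}" "W = lie_class {x1, x2} t" using W by (rule lcarrier_free_lieE)
  obtain ns where ns: "homog_sum G {e1, e2} ns W"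
    using G.ex_homog_sum[OF B _ t(1), of "gen {x1, x2}"] lie_eval_Var[OF t(1)] t(2) by auto
  obtain m :: 'p where m: "\<And>n. n \<in> set ns \<Longrightarrow> n \<noteq> k \<Longrightarrow> m ^ n \<noteq> m ^ k"
    by (rule ex_distinct_powers[OF infinite_field, where ns = ns and k = k]) blast
  have me: "lscale G m e1 \<in> lcarrier G" "lscale G m e2 \<in> lcarrier G"
    by (simp_all add: G.scale_closed)
  show ?thesis
  proof (rule G.eigenvector_homog[OF B homsD[OF ev_in[OF G me]] _ W eig homog.zero ns _ m])
    show "b \<in> {e1, e2} \<Longrightarrow> ev G (lscale G m e1) (lscale G m e2) b = lscale G m b" for b
      using ev_e1[OF G me] ev_e2[OF G me] by auto
    show "W = ladd G (lzero G) W" using G.add_zero[OF W] by simp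
  qed
qed

lemma s_add:
  assumes A: "A \<in> obs" and a: "a \<in> lcarrier A" and b: "b \<in> lcarrier A"
  shows "s A (ladd A a b) = ladd (\<phi>o A) (s A a) (s A b)"
proof -
  interpret G: lie_algebra G by (rule lie_algebra_free_lie)
  let ?w = "ladd G e1 e2"
  have w: "?w \<in> lcarrier G" by (simp add: G.add_closed)
  have ev_w: "ev A a b ?w = ladd A a b" if "A \<in> obs" "a \<in> lcarrier A" "b \<in> lcarrier A" for A a b
    using lie_hom_add[OF homsD[OF ev_in[OF that]] e_closed] ev_e1[OF that] ev_e2[OF that] by simp
  obtain W where W: "W \<in> lcarrier G"
    and trans: "\<And>A a b. \<lbrakk>A \<in> obs; a \<in> lcarrier A; b \<in> lcarrier A\<rbrakk> \<Longrightarrow>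
      s A (ev A a b ?w) = ev (\<phi>o A) (s A a) (s A b) W"
    using ex_transported_operation[OF w] by blast
  have "homog G {e1, e2} 1 W"
  proof (rule transported_homog[OF w W trans])
    fix A a b l assume A: "A \<in> obs" "a \<in> lcarrier A" "b \<in> lcarrier A"
    interpret A: lie_algebra A by (rule ob_lie_algebra[OF A(1)])
    show "ev A (lscale A l a) (lscale A l b) ?w = lscale A (l ^ 1) (ev A a b ?w)"
      using A by (simp add: ev_w A.scale_closed A.scale_add_right)
  qed
  then obtain c d where cd: "W = ladd G (lscale G c e1) (lscale G d e2)"
    using G.homog_1[OF e_closed] by blast
  have sum: "s A (ladd A a b) = ladd (\<phi>o A) (lscale (\<phi>o A) c (s A a)) (lscale (\<phi>o A) d (s A b))"
    if A: "A \<in> obs" and a: "a \<in> lcarrier A" and b: "b \<in> lcarrier A" for A a b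
  proof -
    note sab = obj[OF A] s_closed[OF A a] s_closed[OF A b]
    have "s A (ladd A a b) = ev (\<phi>o A) (s A a) (s A b) W" using trans[OF that] ev_w[OF that] by simp
    then show ?thesis
      by (simp add: cd lie_hom_add[OF homsD[OF ev_in[OF sab]]] lie_hom_scale[OF homsD[OF ev_in[OF sab]]]
          ev_e1[OF sab] ev_e2[OF sab] G.scale_closed)
  qed
  interpret F0: lie_algebra F0 by (rule lie_algebra_free_lie)
  interpret E0: lie_algebra E0 by (rule lie_algebra_free_lie)
  have g: "gen {x0} x0 \<in> lcarrier F0" "gen {y0} y0 \<in> lcarrier E0" by simp_all
  have z: "s F0 (lzero F0) = lzero E0" using s_zero[OF F0] \<phi>o_x0 by simp
  \<comment> \<open>both coefficients are 1: evaluate at the generator and zero, in either order\<close>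
  have "lscale E0 1 (gen {y0} y0) = lscale E0 c (gen {y0} y0)"
    using sum[OF F0 g(1) F0.zero_closed] g z \<phi>o_x0
    by (simp add: F0.add_zero_right E0.add_zero_right E0.scale_zero_right s_gen0 E0.scale_closed E0.scale_one)
  then have c: "c = 1" using y0_scale_eq by metis
  have "lscale E0 1 (gen {y0} y0) = lscale E0 d (gen {y0} y0)"
    using sum[OF F0 F0.zero_closed g(1)] g z \<phi>o_x0
    by (simp add: F0.add_zero E0.add_zero E0.scale_zero_right s_gen0 E0.scale_closed E0.scale_one)
  then have d: "d = 1" using y0_scale_eq by metis
  interpret Q: lie_algebra "\<phi>o A" by (rule ob_lie_algebra[OF obj[OF A]])
  show ?thesis using sum[OF A a b] s_closed[OF A] a b by (simp add: c d Q.scale_one)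
qed

lemma s_bracket:
  obtains c where "c \<noteq> 0"
    and "\<And>A a b. \<lbrakk>A \<in> obs; a \<in> lcarrier A; b \<in> lcarrier A\<rbrakk> \<Longrightarrow>
      s A (lbracket A a b) = lscale (\<phi>o A) c (lbracket (\<phi>o A) (s A a) (s A b))"
proof -
  interpret G: lie_algebra G by (rule lie_algebra_free_lie)
  let ?w = "lbracket G e1 e2"
  have w: "?w \<in> lcarrier G" by (simp add: G.bracket_closed)
  have ev_w: "ev A a b ?w = lbracket A a b" if "A \<in> obs" "a \<in> lcarrier A" "b \<in> lcarrier A" for A a b
    using lie_hom_bracket[OF homsD[OF ev_in[OF that]] e_closed] ev_e1[OF that] ev_e2[OF that] by simp
  obtain W where W: "W \<in> lcarrier G"
    and trans: "\<And>A a b. \<lbrakk>A \<in> obs; a \<in> lcarrier A; b \<in> lcarrier A\<rbrakk> \<Longrightarrow>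
      s A (ev A a b ?w) = ev (\<phi>o A) (s A a) (s A b) W"
    using ex_transported_operation[OF w] by blast
  have "homog G {e1, e2} 2 W"
  proof (rule transported_homog[OF w W trans])
    fix A a b l assume A: "A \<in> obs" "a \<in> lcarrier A" "b \<in> lcarrier A"
    interpret A: lie_algebra A by (rule ob_lie_algebra[OF A(1)])
    show "ev A (lscale A l a) (lscale A l b) ?w = lscale A (l ^ 2) (ev A a b ?w)"
      using A by (simp add: ev_w A.scale_closed A.bracket_scale_left A.bracket_scale_right
          A.bracket_closed power2_eq_square A.scale_scale)
  qed
  then obtain c where c: "W = lscale G c ?w" using G.homog_2[OF e_closed] by blast
  have br: "s A (lbracket A a b) = lscale (\<phi>o A) c (lbracket (\<phi>o A) (s A a) (s A b))"
    if A: "A \<in> obs" and a: "a \<in> lcarrier A" and b: "b \<in> lcarrier A" for A a b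
  proof -
    note sab = obj[OF A] s_closed[OF A a] s_closed[OF A b]
    have "s A (lbracket A a b) = ev (\<phi>o A) (s A a) (s A b) W" using trans[OF that] ev_w[OF that] by simp
    then show ?thesis
      by (simp add: c lie_hom_scale[OF homsD[OF ev_in[OF sab]]] w ev_w[OF sab])
  qed
  have "c \<noteq> 0"
  proof
    assume "c = 0"
    interpret Q: lie_algebra "\<phi>o G" by (rule ob_lie_algebra[OF obj[OF G]])
    have "s G ?w = lzero (\<phi>o G)"
      using br[OF G e_closed] s_closed[OF G] \<open>c = 0\<close> by (simp add: Q.scale_zero Q.bracket_closed)
    also have "\<dots> = s G (lzero G)" using s_zero[OF G] by simp
    finally have "?w = lzero G"
      using inj_onD[OF bij_betw_imp_inj_on[OF bij_s[OF G]]] w G.zero_closed by blast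
    moreover have "?w \<noteq> lzero G" by (rule gen_bracket_neq_zero[OF _ _ x12]) simp_all
    ultimately show False by simp
  qed
  then show thesis using br by (rule that)
qed

lemma field_automorphism_\<sigma>: "field_automorphism \<sigma>"
proof -
  interpret F0: lie_algebra F0 by (rule lie_algebra_free_lie)
  interpret E0: lie_algebra E0 by (rule lie_algebra_free_lie)
  have "\<sigma> (a + b) = \<sigma> a + \<sigma> b" for a b
  proof (rule y0_scale_eq)
    have "s F0 (lscale F0 (a + b) (gen {x0} x0)) =
        ladd E0 (s F0 (lscale F0 a (gen {x0} x0))) (s F0 (lscale F0 b (gen {x0} x0)))"
      using s_add[OF F0 F0.scale_closed F0.scale_closed] \<phi>o_x0 by (simp add: F0.scale_add_left)
    then show "lscale E0 (\<sigma> (a + b)) (gen {y0} y0) = lscale E0 (\<sigma> a + \<sigma> b) (gen {y0} y0)"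
      by (simp add: s_F0 E0.scale_add_left)
  qed
  then show ?thesis by (simp add: field_automorphism_def bij_\<sigma> \<sigma>_1 \<sigma>_mult)
qed

text \<open>Multiplying the bijections by the constant \<open>c\<close> of the transported bracket turns them into
  semi-isomorphisms: \<open>c s[a, b] = c c [s a, s b] = [c s a, c s b]\<close>. This does not affect the formula
  for the automorphism, whose values are linear maps.\<close>

theorem semi_inner:
  "\<exists>s'. (\<forall>F \<in> obs. semi_isomorphism F (\<phi>o F) \<sigma> (s' F)) \<and>
    (\<forall>F1 \<nu> F2. (F1, \<nu>, F2) \<in> Mor (free_lie_category V) \<longrightarrow>
      \<phi>m (F1, \<nu>, F2) =
        (\<phi>o F1,
         restrict (s' F2 \<circ> \<nu> \<circ> inv_into (lcarrier F1) (s' F1)) (lcarrier (\<phi>o F1)),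
         \<phi>o F2))"
proof -
  obtain c where c: "c \<noteq> 0" and br: "\<And>A a b. \<lbrakk>A \<in> obs; a \<in> lcarrier A; b \<in> lcarrier A\<rbrakk> \<Longrightarrow>
      s A (lbracket A a b) = lscale (\<phi>o A) c (lbracket (\<phi>o A) (s A a) (s A b))"
    using s_bracket by blast
  define s' where "s' A a = lscale (\<phi>o A) c (s A a)" for A a
  have bij: "bij_betw (s' A) (lcarrier A) (lcarrier (\<phi>o A))" if A: "A \<in> obs" for A
  proof -
    interpret Q: lie_algebra "\<phi>o A" by (rule ob_lie_algebra[OF obj[OF A]])
    have "bij_betw (lscale (\<phi>o A) c) (lcarrier (\<phi>o A)) (lcarrier (\<phi>o A))"
      by (rule bij_betw_byWitness[where f' = "lscale (\<phi>o A) (inverse c)"])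
        (use c in \<open>auto simp: Q.scale_closed Q.scale_one simp flip: Q.scale_scale\<close>)
    from bij_betw_trans[OF bij_s[OF A] this] show ?thesis
      by (simp add: s'_def[abs_def] o_def)
  qed
  have semi: "semi_isomorphism A (\<phi>o A) \<sigma> (s' A)" if A: "A \<in> obs" for A
  proof -
    interpret A: lie_algebra A by (rule ob_lie_algebra[OF A])
    interpret Q: lie_algebra "\<phi>o A" by (rule ob_lie_algebra[OF obj[OF A]])
    show ?thesis
      unfolding semi_isomorphism_def semimorphism_def lie_ring_hom_def
    proof (intro conjI ballI allI)
      fix a l assume a: "a \<in> lcarrier A"
      show "s' A a \<in> lcarrier (\<phi>o A)" using a by (simp add: s'_def s_closed[OF A] Q.scale_closed)
      show "s' A (lscale A l a) = lscale (\<phi>o A) (\<sigma> l) (s' A a)"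
        using a by (simp add: s'_def s_scale[OF A] s_closed[OF A] mult.commute flip: Q.scale_scale)
      fix b assume b: "b \<in> lcarrier A"
      show "s' A (ladd A a b) = ladd (\<phi>o A) (s' A a) (s' A b)"
        using a b by (simp add: s'_def s_add[OF A] s_closed[OF A] Q.scale_add_right)
      show "s' A (lbracket A a b) = lbracket (\<phi>o A) (s' A a) (s' A b)"
        using a b by (simp add: s'_def br[OF A] s_closed[OF A] Q.bracket_scale_left
            Q.bracket_scale_right Q.scale_closed)
    qed (use bij[OF A] field_automorphism_\<sigma> in auto)
  qed
  have "\<phi>m (A, h, B) = (\<phi>o A,
      restrict (s' B \<circ> h \<circ> inv_into (lcarrier A) (s' A)) (lcarrier (\<phi>o A)), \<phi>o B)"
    if "(A, h, B) \<in> Mor (free_lie_category V)" for A h B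
  proof -
    from that have A: "A \<in> obs" and B: "B \<in> obs" and h: "h \<in> lie_homs A B" by (simp_all add: Mor_iff)
    note \<Phi>h = \<Phi>_in[OF A B h]
    have "\<Phi> A B h b = restrict (s' B \<circ> h \<circ> inv_into (lcarrier A) (s' A)) (lcarrier (\<phi>o A)) b" for b
    proof (cases "b \<in> lcarrier (\<phi>o A)")
      case True
      then obtain a where a: "a \<in> lcarrier A" "b = s' A a"
        using bij[OF A] by (auto simp: bij_betw_def)
      have "inv_into (lcarrier A) (s' A) b = a"
        using a inv_into_f_f[OF bij_betw_imp_inj_on[OF bij[OF A]]] by simp
      moreover have "\<Phi> A B h b = s' B (h a)"
        using a by (simp add: s'_def lie_hom_scale[OF homsD[OF \<Phi>h]] s_closed[OF A] s_natural[OF A B h])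
      ultimately show ?thesis using True by simp
    next
      case False
      then show ?thesis using \<Phi>h by (simp add: lie_homs_def extensional_def)
    qed
    then show ?thesis using \<phi>m_eq[OF A B h] by auto
  qed
  with semi show ?thesis by blast
qed

end

theorem theorem1:
  fixes V :: "'v set"
    and \<phi>o :: "('p::field, 'v) free_lie_struct \<Rightarrow> ('p, 'v) free_lie_struct"
    and \<phi>m :: "('p, 'v) free_lie_mor \<Rightarrow> ('p, 'v) free_lie_mor"
  assumes "infinite (UNIV :: 'p set)"
    and "infinite V"
    and "category_automorphism (free_lie_category V) \<phi>o \<phi>m"
  shows "\<exists>\<sigma> s. field_automorphism \<sigma> \<and>
    (\<forall>F \<in> Ob (free_lie_category V). semi_isomorphism F (\<phi>o F) \<sigma> (s F)) \<and>
    (\<forall>F\<^sub>1 \<nu> F\<^sub>2. (F\<^sub>1, \<nu>, F\<^sub>2) \<in> Mor (free_lie_category V) \<longrightarrow>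
      \<phi>m (F\<^sub>1, \<nu>, F\<^sub>2) =
        (\<phi>o F\<^sub>1,
         restrict (s F\<^sub>2 \<circ> \<nu> \<circ> inv_into (lcarrier F\<^sub>1) (s F\<^sub>1)) (lcarrier (\<phi>o F\<^sub>1)),
         \<phi>o F\<^sub>2))"
proof -
  interpret free_lie_automorphism V \<phi>o \<phi>m by (rule free_lie_automorphism.intro) (fact assms(1) assms(3))+
  obtain x1 where x1: "x1 \<in> V" using assms(2) by (metis finite.emptyI ex_in_conv)
  have "infinite (V - {x1})" using assms(2) by simp
  then obtain x2 where x2: "x2 \<in> V" "x1 \<noteq> x2" by (metis Diff_iff finite.emptyI ex_in_conv singletonI)
  obtain y0 where y0: "y0 \<in> V" "\<phi>o (free_lie {x1}) = free_lie {y0}" using ex_generator[OF x1] by blast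
  interpret based_automorphism V \<phi>o \<phi>m x1 y0 x1 x2
    by unfold_locales (use x1 x2 y0 in auto)
  show ?thesis
    using field_automorphism_\<sigma> semi_inner unfolding cat_simps(1) by blast
qed

end
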